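(* The decision problem WeaklyCausalCorrelations is in the complexity class $\mathsf P$. Here WeaklyCausalCorrelations is the problem: given an integer $n\ge 2$ and the encoding $\langle\bm p\rangle$ of a rational probability vector $\bm p=(\bm p^0,\bm p^1)$ of dimension $2n(n-1)$, decide whether or not $\bm p\in\tilde{\mathcal P}_n^{\text{causal}}$, the polytope of $n$-party weakly causal correlations.
   Context: Notation: $[n]=\{0,\dots,n-1\}$; $[n]^2_{\neq}$ is the set of ordered pairs $(s,r)\in[n]\times[n]$ with $s\neq r$; $d:=n(n-1)$. Vectors in $\mathbb R^{d}$ are indexed by $[n]^2_{\neq}$ and products of vectors such as $\bm\phi\bm w$ are element-wise. A vector in $\mathbb R^{2d}$ is written $\bm p=(\bm p^0,\bm p^1)$ with $\bm p^0,\bm p^1\in\mathbb R^d$; it represents a conditional distribution $P_{A|S,R,X}$ through $\bm p^x_{s,r}=p(0|s,r,x)$, $x\in\{0,1\}$; a probability vector is one with all entries in $[0,1]$. Kefalopoda digraph: for a function $f:[n]\to[n]$ without fixed points, $\kappa_f$ is the digraph with vertex set $[n]$ and arc set $\{f(i)\to i\mid i\in[n]\}$; its adjacency vector $\bm\alpha(\kappa_f)\in\{0,1\}^d$ has entry $1$ at $(i,j)$ if and only if $i\to j$ is an arc of $\kappa_f$. Weakly causal correlations: $\tilde{\mathcal P}_n^{\text{causal}}\subseteq\mathbb R^{2d}$ is the set of all $\bm p=(\bm p^0,\bm p^1)$ such that every entry of $\bm p$ lies in $[0,1]$ and $$(\bm\phi\,\bm\alpha(\kappa_f))\cdot(\bm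 p^0-\bm p^1)\le n-1$$ for every fixed-point-free $f:[n]\to[n]$ and every $\bm\phi\in\{-1,+1\}^d$. Encoding: each rational entry $a/b$ is given as a pair $(a,b)$ of integers whose binary encodings have length bounded by $q(m)$, where $m$ is the dimension of the vector and $q$ is a fixed polynomial. *)

theory Defs
  imports
    Complex_Main
    "HOL-Library.FuncSet"
    "HOL-Computational_Algebra.Polynomial"
    "Graph_Theory.Pair_Digraph"
begin

section \<open>Deterministic polynomial time\<close>

text \<open>
  Deterministic Turing machines with finitely many tapes, each infinite in both directions.
  Tape 0 initially holds the input, with the scanning position on its first letter; the other
  tapes start out blank. States and auxiliary tape symbols are natural numbers, restricted
  to finite sets by \<open>turing_machine\<close>.
\<close>

datatype move = Left | Stay | Right

datatype 'a symbol = Blank | Letter 'a | Aux nat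

record 'a tm =
  num_tapes :: nat
  states :: "nat set"
  symbols :: "'a symbol set"
  start :: nat
  accept :: nat
  reject :: nat
  delta :: "nat \<Rightarrow> 'a symbol list \<Rightarrow> nat \<times> ('a symbol \<times> move) list"

definition turing_machine :: "'a tm \<Rightarrow> bool" where
  "turing_machine M \<longleftrightarrow>
     num_tapes M \<ge> 1 \<and> finite (states M) \<and> finite (symbols M) \<and>
     Blank \<in> symbols M \<and> range Letter \<subseteq> symbols M \<and>
     start M \<in> states M \<and> accept M \<in> states M \<and> reject M \<in> states M \<and>
     accept M \<noteq> reject M \<and>
     (\<forall>s \<in> states M - {accept M, reject M}. \<forall>xs.
        length xs = num_tapes M \<and> set xs \<subseteq> symbols M \<longrightarrow>
        (case delta M s xs of (s', as) \<Rightarrow>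
           s' \<in> states M \<and> length as = num_tapes M \<and> fst ` set as \<subseteq> symbols M))"

text \<open>A tape is its contents together with the scanned position.\<close>

type_synonym 'a tape = "(int \<Rightarrow> 'a symbol) \<times> int"

type_synonym 'a config = "nat \<times> 'a tape list"

definition read_tape :: "'a tape \<Rightarrow> 'a symbol" where
  "read_tape t = fst t (snd t)"

definition act :: "'a symbol \<times> move \<Rightarrow> 'a tape \<Rightarrow> 'a tape" where
  "act a t = ((fst t)(snd t := fst a),
              (case snd a of Left \<Rightarrow> snd t - 1 | Stay \<Rightarrow> snd t | Right \<Rightarrow> snd t + 1))"

definition step :: "'a tm \<Rightarrow> 'a config \<Rightarrow> 'a config" where
  "step M c =
     (case c of (s, ts) \<Rightarrow>
        if s = accept M \<or> s = reject M then c
        else (case delta M s (map read_tape ts) of (s', as) \<Rightarrow> (s', map2 act as ts)))"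

definition input_tape :: "'a list \<Rightarrow> 'a tape" where
  "input_tape w = ((\<lambda>i. if 0 \<le> i \<and> i < int (length w) then Letter (w ! nat i) else Blank), 0)"

definition init :: "'a tm \<Rightarrow> 'a list \<Rightarrow> 'a config" where
  "init M w = (start M, input_tape w # replicate (num_tapes M - 1) (input_tape []))"

definition decides_in_time :: "'a tm \<Rightarrow> 'a list set \<Rightarrow> (nat \<Rightarrow> nat) \<Rightarrow> bool" where
  "decides_in_time M L T \<longleftrightarrow>
     (\<forall>w. \<exists>t \<le> T (length w).
        fst ((step M ^^ t) (init M w)) = (if w \<in> L then accept M else reject M))"

definition class_P :: "'a::finite list set set" where
  "class_P = {L. \<exists>M (p :: nat poly). turing_machine M \<and> decides_in_time M L (poly p)}"


section \<open>Weakly causal correlations\<close>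

definition index_pairs :: "nat \<Rightarrow> (nat \<times> nat) set" where
  "index_pairs n = {(s, r). s < n \<and> r < n \<and> s \<noteq> r}"

definition kefalopoda :: "nat \<Rightarrow> (nat \<Rightarrow> nat) \<Rightarrow> nat pair_pre_digraph" where
  "kefalopoda n f = \<lparr>pverts = {..<n}, parcs = {(f i, i) | i. i < n}\<rparr>"

definition adjacency_vector :: "nat pair_pre_digraph \<Rightarrow> nat \<times> nat \<Rightarrow> real" where
  "adjacency_vector G e = (if e \<in> parcs G then 1 else 0)"

text \<open>
  \<open>\<real>\<^sup>d\<close> is represented by the extensional real functions on \<open>index_pairs n\<close>, and
  \<open>\<real>\<^sup>2\<^sup>d\<close> by pairs \<open>(p0, p1)\<close> of such functions, where \<open>px (s, r)\<close> is \<open>p(0|s,r,x)\<close>.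
\<close>

type_synonym vec = "nat \<times> nat \<Rightarrow> real"

definition probability_vectors :: "nat \<Rightarrow> (vec \<times> vec) set" where
  "probability_vectors n =
     (index_pairs n \<rightarrow>\<^sub>E {0..1}) \<times> (index_pairs n \<rightarrow>\<^sub>E {0..1})"

definition weakly_causal :: "nat \<Rightarrow> (vec \<times> vec) set" where
  "weakly_causal n =
     {(p0, p1) \<in> probability_vectors n.
        \<forall>f \<in> {..<n} \<rightarrow>\<^sub>E {..<n}. (\<forall>i<n. f i \<noteq> i) \<longrightarrow>
          (\<forall>\<phi> \<in> index_pairs n \<rightarrow>\<^sub>E {-1, 1}.
             (\<Sum>e\<in>index_pairs n. \<phi> e * adjacency_vector (kefalopoda n f) e * (p0 e - p1 e))
               \<le> real n - 1)}"


section \<open>The decision problem\<close>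

datatype letter = Zero | One | Minus | Sep

instance letter :: finite
proof
  have "(UNIV :: letter set) \<subseteq> {Zero, One, Minus, Sep}"
    using letter.exhaust by blast
  then show "finite (UNIV :: letter set)"
    by (rule finite_subset) simp
qed

text \<open>Most significant bit first, without leading zeros.\<close>

fun binary :: "nat \<Rightarrow> letter list" where
  "binary n =
     (if n < 2 then [] else binary (n div 2)) @ [if even n then Zero else One]"

declare binary.simps [simp del]

definition binary_int :: "int \<Rightarrow> letter list" where
  "binary_int a = (if a < 0 then [Minus] else []) @ binary (nat \<bar>a\<bar>)"

definition encode :: "nat \<Rightarrow> (int \<times> int) list \<Rightarrow> letter list" where
  "encode n ps = binary n @ concat (map (\<lambda>(a, b). Sep # binary_int a @ Sep # binary_int b) ps)"

text \<open>The lexicographic enumeration of \<open>index_pairs n\<close>.\<close>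

definition index_list :: "nat \<Rightarrow> (nat \<times> nat) list" where
  "index_list n = [(s, r). s \<leftarrow> [0..<n], r \<leftarrow> [0..<n], s \<noteq> r]"

text \<open>
  The pairs \<open>(a, b)\<close> represent the entries \<open>a / b\<close> of \<open>p0\<close> followed by those of \<open>p1\<close>. The
  fractions need not be in lowest terms, so that a vector may have several encodings.
\<close>

definition encodes :: "int poly \<Rightarrow> nat \<Rightarrow> letter list \<Rightarrow> vec \<times> vec \<Rightarrow> bool" where
  "encodes q n w p \<longleftrightarrow>
     (\<exists>ps. w = encode n ps \<and>
        (\<forall>(a, b) \<in> set ps. b \<noteq> 0 \<and>
           int (length (binary_int a)) \<le> poly q (int (2 * (n * (n - 1)))) \<and>
           int (length (binary_int b)) \<le> poly q (int (2 * (n * (n - 1))))) \<and>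
        map (\<lambda>(a, b). of_int a / of_int b) ps =
          map (fst p) (index_list n) @ map (snd p) (index_list n))"

text \<open>
  The language of all encodings of yes-instances; words that do not encode a rational
  probability vector of the required size are not in the language.
\<close>

definition weakly_causal_correlations :: "int poly \<Rightarrow> letter list set" where
  "weakly_causal_correlations q =
     {w. \<exists>n p. n \<ge> 2 \<and> p \<in> probability_vectors n \<and> encodes q n w p \<and> p \<in> weakly_causal n}"

end

theory Submission
  imports Defs "HOL-Library.Countable_Set"
begin

text \<open>
  Taking for each receiver \<open>r\<close> the sender \<open>s\<close> and the sign that maximise the contribution of the arc
  \<open>s \<rightarrow> r\<close> turns the exponentially many inequalities into the single condition
  \<open>\<Sum>r. max\<^sub>s\<^sub>\<noteq>\<^sub>r \<bar>p0 (s, r) - p1 (s, r)\<bar> \<le> n - 1\<close>. Scaling by the product of all denominators, whose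
  length is at most that of the input, makes this a comparison of integers.

  To obtain an actual machine, programs with integer registers are compiled to Turing machines.
  Their only loop runs once over the letters of the input and their only arithmetic is addition and
  subtraction, so that all programs take polynomial time: the registers are tracks of signed binary
  digits on one tape, an assignment is one sweep over that tape, and every assignment lengthens it
  by one cell. The decision procedure is then written as a function built from operations that
  such programs can compute.
\<close>


section \<open>Programs over integer registers\<close>

text \<open>The obstacle is to exhibit a concrete machine together with a proved time bound. Digits
  -1, 0, 1 are chosen because addition and subtraction then become the same operation, a carry is
  again one digit, and the sign is that of the most significant nonzero digit: a pass from the low
  end with finite memory yields both the result and its sign. Values may become exponentially large,
  but their lengths stay polynomial. Multiplication is needed in two restricted forms only: by
  factors capped at the input length, which is repeated addition, and by numbers written in the
  input, which is doubling while their digits are read. Loops up to \<open>n\<close> are obtained by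
  counting along the letters of the input, hence are capped at its length. On malformed words
  \<open>n\<close> may exceed that length exponentially; in a genuine encoding it cannot, since
  \<open>n \<le> n * (n - 1)\<close> for \<open>n \<ge> 2\<close> and every entry takes up letters.
  So the cap never changes the answer on such words, and all others are rejected.\<close>

datatype 'a com =
    Skip
  | Seq "'a com" "'a com"
  | Upd nat int nat int "'a com" "'a com"
  | For "'a \<Rightarrow> 'a com"

text \<open>\<open>Upd\<close> fuses an assignment with a branch because one sweep over the tracks
  delivers the new value and its sign together. Applying \<open>sgn\<close> to \<open>s\<close> and
  \<open>c\<close> keeps both of them digits without a side condition on programs.\<close>

primrec sem :: "'a list \<Rightarrow> 'a com \<Rightarrow> (nat \<Rightarrow> int) \<Rightarrow> nat \<Rightarrow> int" where
  "sem w Skip R = R"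
| "sem w (Seq a b) R = sem w b (sem w a R)"
| "sem w (Upd i s j c a b) R =
     (let R' = R(i := R i + sgn s * R j + sgn c) in if R' i > 0 then sem w a R' else sem w b R')"
| "sem w (For f) R = fold (\<lambda>a. sem w (f a)) w R"

text \<open>An upper bound for the registers ever written, with sums in place of maxima. A register
  that is only read keeps its initial value 0, which agrees with digit vectors being 0 beyond the
  last track.\<close>

primrec num_regs :: "'a::finite com \<Rightarrow> nat" where
  "num_regs Skip = 0"
| "num_regs (Seq a b) = num_regs a + num_regs b"
| "num_regs (Upd i s j c a b) = Suc i + num_regs a + num_regs b"
| "num_regs (For f) = (\<Sum>a\<in>UNIV. num_regs (f a))"

text \<open>Bounds the nesting of loops, and so the number of input copies with independent heads.
  Adding over \<open>Seq\<close> overestimates it.\<close>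

primrec depth :: "'a::finite com \<Rightarrow> nat" where
  "depth Skip = 0"
| "depth (Seq a b) = depth a + depth b"
| "depth (Upd i s j c a b) = depth a + depth b"
| "depth (For f) = Suc (\<Sum>a\<in>UNIV. depth (f a))"

text \<open>Serves two bounds at once, as a polynomial in the input length: the cells gained by the
  work tape, and the number of steps measured in traversals of that tape. The constants of
  \<open>For\<close> pay for entering an iteration, advancing and rewinding.\<close>

primrec cost :: "'a::finite com \<Rightarrow> nat poly" where
  "cost Skip = 1"
| "cost (Seq a b) = 1 + cost a + cost b"
| "cost (Upd i s j c a b) = 1 + cost a + cost b"
| "cost (For f) = 3 + [:0, 1:] * (3 + (\<Sum>a\<in>UNIV. cost (f a)))"

lemma num_regs_For: "num_regs (f a) \<le> num_regs (For f)"
  by (simp add: member_le_sum[where f = "\<lambda>a. num_regs (f a)"])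

lemma depth_For: "depth (f a) < depth (For f)"
  by (simp add: less_Suc_eq_le member_le_sum[where f = "\<lambda>a. depth (f a)"])

lemma poly_sum_nat: "poly (\<Sum>a\<in>A. p a) (x::nat) = (\<Sum>a\<in>A. poly (p a) x)"
  by (induction A rule: infinite_finite_induct) auto

lemma cost_For: "poly (cost (For f)) N = 3 + N * (3 + (\<Sum>a\<in>UNIV. poly (cost (f a)) N))"
proof -
  have "poly 3 N = (3::nat)"
    by (metis of_nat_numeral poly_of_nat of_nat_id)
  then show ?thesis by (simp add: poly_sum_nat)
qed


section \<open>Integers as signed binary digits\<close>

definition digit_vectors :: "nat \<Rightarrow> (nat \<Rightarrow> int) set" where
  "digit_vectors K = {v. \<forall>r. (r \<in> {..<K} \<longrightarrow> v r \<in> {-1, 0, 1}) \<and> (r \<notin> {..<K} \<longrightarrow> v r = 0)}"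

lemma finite_digit_vectors: "finite (digit_vectors K)"
  unfolding digit_vectors_def by (rule finite_set_of_finite_funs) auto

lemma digit_vectorsD: "v \<in> digit_vectors K \<Longrightarrow> v r \<in> {-1, 0, 1}"
  unfolding digit_vectors_def by (cases "r < K") auto

lemma zero_digit_vectors: "(\<lambda>_. 0) \<in> digit_vectors K"
  by (simp add: digit_vectors_def)

lemma update_digit_vectors:
  "v \<in> digit_vectors K \<Longrightarrow> i < K \<Longrightarrow> d \<in> {-1, 0, 1} \<Longrightarrow> v(i := d) \<in> digit_vectors K"
  by (auto simp: digit_vectors_def)

text \<open>Lists of digit vectors are least significant digit first; each vector has one digit per register.\<close>

primrec val :: "(nat \<Rightarrow> int) list \<Rightarrow> nat \<Rightarrow> int" where
  "val [] r = 0"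
| "val (v # vs) r = v r + 2 * val vs r"

definition carry :: "int \<Rightarrow> int" where
  "carry t = (if t > 1 then 1 else if t < -1 then -1 else 0)"

lemma carry_digit: "carry t \<in> {-1, 0, 1}"
  by (simp add: carry_def)

text \<open>The sum lies between -3 and 3, exactly the range of \<open>2 * c' + d\<close> for digits
  \<open>c'\<close> and \<open>d\<close>. Hence carries never outgrow one digit and fit into the
  control state.\<close>

lemma carry_remainder:
  assumes "a \<in> {-1, 0, 1}" "s \<in> {-1, 0, 1}" "b \<in> {-1, 0, 1}" "c \<in> {-1, 0, 1::int}"
  shows "a + s * b + c - 2 * carry (a + s * b + c) \<in> {-1, 0, 1}"
  using assms by (auto simp: carry_def)

text \<open>The last carry becomes a new most significant digit even when it is 0, so the length
  grows by exactly one whatever the data.\<close>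

primrec sweep :: "nat \<Rightarrow> int \<Rightarrow> nat \<Rightarrow> int \<Rightarrow> (nat \<Rightarrow> int) list \<Rightarrow> (nat \<Rightarrow> int) list" where
  "sweep i s j c [] = [(\<lambda>_. 0)(i := c)]"
| "sweep i s j c (v # vs) =
     (let t = v i + s * v j + c in v(i := t - 2 * carry t) # sweep i s j (carry t) vs)"

lemma length_sweep [simp]: "length (sweep i s j c vs) = Suc (length vs)"
  by (induction vs arbitrary: c) (auto simp: Let_def)

text \<open>What is subtracted from a digit reappears as a carry of twice the weight, so the total
  is preserved. Since \<open>t\<close> is formed from the old digits, \<open>j = i\<close> is
  allowed; this is how a register is cleared.\<close>

lemma val_sweep_self: "val (sweep i s j c vs) i = val vs i + s * val vs j + c"
  by (induction vs arbitrary: c) (auto simp: Let_def algebra_simps)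

lemma val_sweep_other: "r \<noteq> i \<Longrightarrow> val (sweep i s j c vs) r = val vs r"
  by (induction vs arbitrary: c) (auto simp: Let_def)

lemma val_sweep: "val (sweep i s j c vs) = (val vs)(i := val vs i + s * val vs j + c)"
  by (rule ext) (simp add: val_sweep_self val_sweep_other)

lemma sweep_digit_vectors:
  assumes "set vs \<subseteq> digit_vectors K" "i < K" "s \<in> {-1, 0, 1}" "c \<in> {-1, 0, 1}"
  shows "set (sweep i s j c vs) \<subseteq> digit_vectors K"
  using assms
proof (induction vs arbitrary: c)
  case Nil
  then show ?case using update_digit_vectors[OF zero_digit_vectors] by simp
next
  case (Cons v vs)
  define t where "t = v i + s * v j + c"
  from Cons.prems have v: "v \<in> digit_vectors K" by simp
  have "t - 2 * carry t \<in> {-1, 0, 1}"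
    unfolding t_def by (intro carry_remainder digit_vectorsD[OF v] Cons.prems)
  then have "v(i := t - 2 * carry t) \<in> digit_vectors K"
    using v Cons.prems(2) by (rule update_digit_vectors[rotated 2])
  moreover have "set (sweep i s j (carry t) vs) \<subseteq> digit_vectors K"
    using Cons.prems by (intro Cons.IH carry_digit) auto
  ultimately show ?case by (simp add: Let_def t_def)
qed

definition sign_from :: "int \<Rightarrow> int \<Rightarrow> int" where
  "sign_from g x = (if x = 0 then g else sgn x)"

text \<open>For a nonzero integer \<open>x\<close>, a digit cannot overturn the sign of
  \<open>2 * x\<close>. So a pass from the low end finds the sign by remembering in \<open>g\<close>
  the sign of the last nonzero digit.\<close>

lemma sign_from_Cons:
  assumes "d \<in> {-1, 0, 1}"
  shows "sign_from g (d + 2 * x) = sign_from (sign_from g d) x"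
  using assms by (auto simp: sign_from_def sgn_if)


section \<open>Compilation to Turing machines\<close>

text \<open>
  The control state is the stack of the items still to be executed. A loop at nesting level \<open>l\<close>
  moves only the head of tape \<open>l\<close>, which holds a copy of the input; tape \<open>D\<close> is the work tape.
\<close>

datatype 'a item =
    Code nat "'a com"
  | Advance nat
  | Rewind nat
  | Sweep nat int nat int int "'a item" "'a item"
  | Return
  | Copy
  | CopyReturn
  | Verdict
  | Accept
  | Reject

definition keep :: "(nat \<Rightarrow> 'a symbol) \<Rightarrow> nat \<Rightarrow> 'a symbol \<times> move" where
  "keep X = (\<lambda>i. (X i, Stay))"

definition cell :: "nat \<Rightarrow> (nat \<Rightarrow> int) \<Rightarrow> 'a symbol" where
  "cell K v = Aux (to_nat_on (digit_vectors K) v)"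

text \<open>An empty stack or a letter on the work tape leads to the default
  \<open>[Reject]\<close>, which keeps the controls closed under every possible reading.
  \<open>Verdict\<close> adds 0 to register 0 for the sake of the sign test that ends a
  sweep.\<close>

fun rule :: "nat \<Rightarrow> nat \<Rightarrow> 'a item list \<Rightarrow> (nat \<Rightarrow> 'a symbol) \<Rightarrow>
    'a item list \<times> (nat \<Rightarrow> 'a symbol \<times> move)" where
  "rule D K [] X = ([Reject], keep X)"
| "rule D K (Code l Skip # k) X = (k, keep X)"
| "rule D K (Code l (Seq a b) # k) X = (Code l a # Code l b # k, keep X)"
| "rule D K (Code l (Upd i s j c a b) # k) X =
     (Sweep i (sgn s) j (sgn c) 0 (Code l a) (Code l b) # k, keep X)"
| "rule D K (Code l (For f) # k) X =
     (case X l of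
        Letter a \<Rightarrow> (Code (Suc l) (f a) # Advance l # Code l (For f) # k, keep X)
      | _ \<Rightarrow> (Rewind l # k, (keep X)(l := (X l, Left))))"
| "rule D K (Advance l # k) X = (k, (keep X)(l := (X l, Right)))"
| "rule D K (Rewind l # k) X =
     (if X l = Blank then (k, (keep X)(l := (X l, Right)))
      else (Rewind l # k, (keep X)(l := (X l, Left))))"
| "rule D K (Sweep i s j c g p q # k) X =
     (case X D of
        Blank \<Rightarrow> (Return # (if sign_from g c > 0 then p else q) # k,
                  (keep X)(D := (cell K ((\<lambda>_. 0)(i := c)), Left)))
      | Aux m \<Rightarrow>
          (let v = from_nat_into (digit_vectors K) m; t = v i + s * v j + c; d = t - 2 * carry t
           in (Sweep i s j (carry t) (sign_from g d) p q # k,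
               (keep X)(D := (cell K (v(i := d)), Right))))
      | Letter a \<Rightarrow> ([Reject], keep X))"
| "rule D K (Return # k) X =
     (if X D = Blank then (k, (keep X)(D := (X D, Right)))
      else (Return # k, (keep X)(D := (X D, Left))))"
| "rule D K (Copy # k) X =
     (if X 0 = Blank then (CopyReturn # k, \<lambda>i. (X i, if i < D then Left else Stay))
      else (Copy # k, \<lambda>i. if i < D then (X 0, Right) else (X i, Stay)))"
| "rule D K (CopyReturn # k) X =
     (if X 0 = Blank then (k, \<lambda>i. (X i, if i < D then Right else Stay))
      else (CopyReturn # k, \<lambda>i. (X i, if i < D then Left else Stay)))"
| "rule D K (Verdict # k) X = ([Sweep 0 0 0 0 0 Accept Reject], keep X)"
| "rule D K (Accept # k) X = (Accept # k, keep X)"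
| "rule D K (Reject # k) X = (Reject # k, keep X)"

section \<open>Runs of the stack machine on its tapes\<close>

definition istep :: "nat \<Rightarrow> nat \<Rightarrow> 'a item list \<times> (nat \<Rightarrow> 'a tape) \<Rightarrow> 'a item list \<times> (nat \<Rightarrow> 'a tape)" where
  "istep D K c = (case rule D K (fst c) (\<lambda>i. read_tape (snd c i)) of (q, A) \<Rightarrow>
     (q, \<lambda>i. if i \<le> D then act (A i) (snd c i) else snd c i))"

definition work :: "nat \<Rightarrow> (nat \<Rightarrow> int) list \<Rightarrow> int \<Rightarrow> 'a symbol" where
  "work K vs = (\<lambda>z. if 0 \<le> z \<and> z < int (length vs) then cell K (vs ! nat z) else Blank)"

definition tapes :: "nat \<Rightarrow> nat \<Rightarrow> 'a list \<Rightarrow> (nat \<Rightarrow> int) \<Rightarrow> (nat \<Rightarrow> int) list \<Rightarrow> int \<Rightarrow> nat \<Rightarrow> 'a tape" where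
  "tapes D K w h vs p =
     (\<lambda>i. if i < D then (fst (input_tape w), h i)
          else if i = D then (work K vs, p) else (\<lambda>_. Blank, 0))"

lemma act_keep [simp]: "act (read_tape t, Stay) t = t"
  by (simp add: act_def read_tape_def)

lemma act_move [simp]:
  "act (read_tape t, Left) t = (fst t, snd t - 1)"
  "act (read_tape t, Right) t = (fst t, snd t + 1)"
  by (simp_all add: act_def read_tape_def)

lemma read_tapes:
  "l < D \<Longrightarrow> read_tape (tapes D K w h vs p l) = fst (input_tape w) (h l)"
  "read_tape (tapes D K w h vs p D) = work K vs p"
  by (simp_all add: tapes_def read_tape_def)

lemma istep_keep:
  assumes "rule D K q (\<lambda>i. read_tape (T i)) = (q', keep (\<lambda>i. read_tape (T i)))"
  shows "istep D K (q, T) = (q', T)"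
  using assms by (simp add: istep_def keep_def cong: if_cong)

lemma istep_head:
  assumes "rule D K q (\<lambda>i. read_tape (T i)) =
      (q', (keep (\<lambda>i. read_tape (T i)))(l := (read_tape (T l), m)))"
    and "T = tapes D K w h vs p" "l < D"
  shows "istep D K (q, T) = (q', tapes D K w (h(l := snd (act (read_tape (T l), m) (T l)))) vs p)"
  using assms(1,3)
  by (cases m) (auto simp: istep_def keep_def fun_eq_iff assms(2) tapes_def)

lemma istep_work:
  assumes "rule D K q (\<lambda>i. read_tape (T i)) =
      (q', (keep (\<lambda>i. read_tape (T i)))(D := (y, m)))"
    and "T = tapes D K w h vs p"
    and "act (y, m) (work K vs, p) = (work K vs', p')"
  shows "istep D K (q, T) = (q', tapes D K w h vs' p')"
  using assms(1,3)
  by (auto simp: istep_def keep_def fun_eq_iff assms(2) tapes_def)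

lemma work_length: "work K vs (int (length vs)) = Blank"
  by (simp add: work_def)

lemma work_neg: "z < 0 \<Longrightarrow> work K vs z = Blank"
  by (simp add: work_def)

lemma work_mid: "work K (xs @ v # ys) (int (length xs)) = cell K v"
  by (simp add: work_def)

lemma work_nonblank: "0 \<le> z \<Longrightarrow> z < int (length vs) \<Longrightarrow> work K vs z \<noteq> Blank"
  by (simp add: work_def cell_def)

lemma work_upd: "(work K (xs @ v # ys))(int (length xs) := cell K v') = work K (xs @ v' # ys)"
  by (auto simp: work_def fun_eq_iff nth_append nth_Cons split: nat.splits)

lemma work_snoc: "(work K xs)(int (length xs) := cell K v') = work K (xs @ [v'])"
  by (auto simp: work_def fun_eq_iff nth_append)

lemma from_nat_into_cell:
  "v \<in> digit_vectors K \<Longrightarrow> from_nat_into (digit_vectors K) (to_nat_on (digit_vectors K) v) = v"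
  using from_nat_into_to_nat_on[OF countable_finite[OF finite_digit_vectors]] by simp

lemma funpow_trans:
  "(f ^^ s) x = y \<Longrightarrow> (f ^^ t) y = z \<Longrightarrow> (f ^^ (s + t)) x = z"
  by (metis add.commute comp_apply funpow_add)

lemma funpow_trans_Suc:
  "f x = y \<Longrightarrow> (f ^^ t) y = z \<Longrightarrow> (f ^^ Suc t) x = z"
  by (metis comp_apply funpow_Suc_right)

text \<open>Prefix \<open>xs\<close>, carry \<open>c\<close> and sign \<open>g\<close> are arbitrary
  because the induction passes through the middle of a sweep. The last step writes the new top cell
  and moves left, so the head ends one cell before it.\<close>

lemma sweep_run:
  assumes "set ys \<subseteq> digit_vectors K" "i < K" "s \<in> {-1, 0, 1}" "c \<in> {-1, 0, 1}"
  shows "(istep D K ^^ Suc (length ys)) (Sweep i s j c g p q # k, tapes D K w h (xs @ ys) (int (length xs)))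
    = (Return # (if sign_from g (val (sweep i s j c ys) i) > 0 then p else q) # k,
       tapes D K w h (xs @ sweep i s j c ys) (int (length xs + length ys) - 1))"
  using assms
proof (induction ys arbitrary: xs c g)
  case Nil
  have "istep D K (Sweep i s j c g p q # k, tapes D K w h xs (int (length xs)))
    = (Return # (if sign_from g c > 0 then p else q) # k,
       tapes D K w h (xs @ [(\<lambda>_. 0)(i := c)]) (int (length xs) - 1))"
    by (rule istep_work[OF _ refl, where y = "cell K ((\<lambda>_. 0)(i := c))" and m = Left])
       (simp_all add: read_tapes work_length act_def work_snoc)
  then show ?case by simp
next
  case (Cons v ys)
  define t where "t = v i + s * v j + c"
  define d where "d = t - 2 * carry t"
  have v: "v \<in> digit_vectors K" using Cons.prems by simp
  have d: "d \<in> {-1, 0, 1}"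
    unfolding d_def t_def by (intro carry_remainder digit_vectorsD[OF v] Cons.prems)
  have 1: "istep D K (Sweep i s j c g p q # k, tapes D K w h (xs @ v # ys) (int (length xs)))
    = (Sweep i s j (carry t) (sign_from g d) p q # k,
       tapes D K w h ((xs @ [v(i := d)]) @ ys) (int (length (xs @ [v(i := d)]))))"
    by (rule istep_work[OF _ refl, where y = "cell K (v(i := d))" and m = Right])
       (simp_all add: read_tapes work_mid cell_def from_nat_into_cell[OF v] act_def Let_def
         d_def t_def work_upd[unfolded cell_def])
  have "set ys \<subseteq> digit_vectors K" using Cons.prems by simp
  note 2 = Cons.IH[OF this Cons.prems(2,3) carry_digit[of t], where g = "sign_from g d" and xs = "xs @ [v(i := d)]"]
  have 3: "sweep i s j c (v # ys) = v(i := d) # sweep i s j (carry t) ys"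
    by (simp add: t_def d_def Let_def)
  show ?case
    using funpow_trans_Suc[OF 1 2] unfolding 3
    by (simp add: sign_from_Cons[OF d] del: funpow.simps)
qed

text \<open>There are \<open>m\<close> moves to the left and one to the right; for
  \<open>m = 0\<close> the head already stands on the blank left of the contents.\<close>

lemma return_run:
  assumes "m \<le> length vs"
  shows "(istep D K ^^ Suc m) (Return # k, tapes D K w h vs (int m - 1)) = (k, tapes D K w h vs 0)"
  using assms
proof (induction m)
  case 0
  have "istep D K (Return # k, tapes D K w h vs (- 1)) = (k, tapes D K w h vs 0)"
    by (rule istep_work[OF _ refl, where y = "work K vs (-1)" and m = Right])
       (simp_all add: read_tapes work_neg act_def fun_upd_idem)
  then show ?case by simp
next
  case (Suc m)
  have 1: "istep D K (Return # k, tapes D K w h vs (int m)) = (Return # k, tapes D K w h vs (int m - 1))"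
    by (rule istep_work[OF _ refl, where y = "work K vs (int m)" and m = Left])
       (use Suc.prems in \<open>simp_all add: read_tapes work_nonblank act_def\<close>)
  show ?case using funpow_trans_Suc[OF 1 Suc.IH] Suc.prems by (simp del: funpow.simps)
qed

lemma input_tape_nth: "m < length w \<Longrightarrow> fst (input_tape w) (int m) = Letter (w ! m)"
  by (simp add: input_tape_def)

lemma input_tape_blank: "z < 0 \<or> z \<ge> int (length w) \<Longrightarrow> fst (input_tape w) z = Blank"
  by (auto simp: input_tape_def)

lemma rewind_run:
  assumes "m \<le> length w" "l < D" "h l = int m - 1"
  shows "(istep D K ^^ Suc m) (Rewind l # k, tapes D K w h vs 0) = (k, tapes D K w (h(l := 0)) vs 0)"
  using assms
proof (induction m arbitrary: h)
  case 0
  have "istep D K (Rewind l # k, tapes D K w h vs 0) =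
      (k, tapes D K w (h(l := snd (act (read_tape (tapes D K w h vs 0 l), Right) (tapes D K w h vs 0 l)))) vs 0)"
    by (rule istep_head[OF _ refl]) (use 0 in \<open>simp_all add: read_tapes input_tape_blank\<close>)
  then show ?case using 0 by (simp add: tapes_def fun_upd_def)
next
  case (Suc m)
  let ?h = "h(l := int m - 1)"
  have "istep D K (Rewind l # k, tapes D K w h vs 0) =
      (Rewind l # k, tapes D K w (h(l := snd (act (read_tape (tapes D K w h vs 0 l), Left) (tapes D K w h vs 0 l)))) vs 0)"
    by (rule istep_head[OF _ refl]) (use Suc.prems in \<open>simp_all add: read_tapes input_tape_nth\<close>)
  then have 1: "istep D K (Rewind l # k, tapes D K w h vs 0) = (Rewind l # k, tapes D K w ?h vs 0)"
    using Suc.prems by (simp add: tapes_def)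
  show ?case
    using funpow_trans_Suc[OF 1 Suc.IH[of ?h]] Suc.prems by (simp cong: if_cong del: funpow.simps)
qed

text \<open>\<open>B\<close> bounds the tape length throughout, so a unit of \<open>cost\<close> is
  worth one sweep and return over at most \<open>B\<close> cells plus bookkeeping, at most
  \<open>2 * B + 10\<close> steps. Heads from \<open>l\<close> on rest at 0, so inner loops find
  their copies of the input rewound.\<close>

lemma com_run:
  fixes c :: "'a::finite com"
  assumes "num_regs c \<le> K" "l + depth c \<le> D" "\<forall>i\<ge>l. h i = 0" "set vs \<subseteq> digit_vectors K"
    and "length vs + poly (cost c) (length w) \<le> B"
  shows "\<exists>t vs'. (istep D K ^^ t) (Code l c # k, tapes D K w h vs 0) = (k, tapes D K w h vs' 0) \<and>
     val vs' = sem w c (val vs) \<and> set vs' \<subseteq> digit_vectors K \<and>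
     length vs' \<le> length vs + poly (cost c) (length w) \<and>
     t \<le> poly (cost c) (length w) * (2 * B + 10)"
  using assms
proof (induction c arbitrary: l h vs k)
  case Skip
  have "(istep D K ^^ 1) (Code l Skip # k, tapes D K w h vs 0) = (k, tapes D K w h vs 0)"
    by (simp add: istep_keep)
  then show ?case using Skip by (intro exI[of _ 1] exI[of _ vs]) simp
next
  case (Seq a b)
  let ?a = "poly (cost a) (length w)" and ?b = "poly (cost b) (length w)"
  have 0: "istep D K (Code l (Seq a b) # k, tapes D K w h vs 0) =
      (Code l a # Code l b # k, tapes D K w h vs 0)"
    by (simp add: istep_keep)
  obtain t vs' where 1: "(istep D K ^^ t) (Code l a # Code l b # k, tapes D K w h vs 0) = (Code l b # k, tapes D K w h vs' 0)"
    "val vs' = sem w a (val vs)" "set vs' \<subseteq> digit_vectors K"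
    "length vs' \<le> length vs + ?a" "t \<le> ?a * (2 * B + 10)"
    using Seq.IH(1)[of l h vs "Code l b # k"] Seq.prems by auto
  obtain u vs'' where 2: "(istep D K ^^ u) (Code l b # k, tapes D K w h vs' 0) = (k, tapes D K w h vs'' 0)"
    "val vs'' = sem w b (val vs')" "set vs'' \<subseteq> digit_vectors K"
    "length vs'' \<le> length vs' + ?b" "u \<le> ?b * (2 * B + 10)"
    using Seq.IH(2)[of l h vs' k] Seq.prems 1(3,4) by auto
  have "(istep D K ^^ Suc (t + u)) (Code l (Seq a b) # k, tapes D K w h vs 0) = (k, tapes D K w h vs'' 0)"
    using funpow_trans_Suc[OF 0 funpow_trans[OF 1(1) 2(1)]] .
  then show ?case using 1 2
    by (intro exI[of _ "Suc (t + u)"] exI[of _ vs'']) (simp add: algebra_simps del: funpow.simps)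
next
  case (Upd i s j c a b)
  let ?a = "poly (cost a) (length w)" and ?b = "poly (cost b) (length w)"
  let ?zs = "sweep i (sgn s) j (sgn c) vs"
  let ?T = "tapes D K w h"
  let ?n = "if val ?zs i > 0 then a else b"
  have i: "i < K" using Upd.prems by simp
  have sg: "sgn s \<in> {-1, 0, 1}" "sgn c \<in> {-1, 0, 1}" by (auto simp: sgn_if)
  have 0: "istep D K (Code l (Upd i s j c a b) # k, ?T vs 0) =
      (Sweep i (sgn s) j (sgn c) 0 (Code l a) (Code l b) # k, ?T vs 0)"
    by (simp add: istep_keep)
  have "sign_from 0 x > 0 \<longleftrightarrow> x > 0" for x by (auto simp: sign_from_def sgn_if)
  then have 1: "(istep D K ^^ Suc (length vs)) (Sweep i (sgn s) j (sgn c) 0 (Code l a) (Code l b) # k, ?T vs 0)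
     = (Return # Code l ?n # k, ?T ?zs (int (length vs) - 1))"
    using sweep_run[OF Upd.prems(4) i sg, of D j 0 "Code l a" "Code l b" k w h "[]"]
    by (simp del: funpow.simps)
  have 2: "(istep D K ^^ Suc (length vs)) (Return # Code l ?n # k, ?T ?zs (int (length vs) - 1))
     = (Code l ?n # k, ?T ?zs 0)"
    by (rule return_run) simp
  have zs: "set ?zs \<subseteq> digit_vectors K" by (rule sweep_digit_vectors[OF Upd.prems(4) i sg])
  have n: "\<exists>t vs'. (istep D K ^^ t) (Code l ?n # k, ?T ?zs 0) = (k, ?T vs' 0) \<and>
     val vs' = sem w ?n (val ?zs) \<and> set vs' \<subseteq> digit_vectors K \<and>
     length vs' \<le> length ?zs + poly (cost ?n) (length w) \<and>
     t \<le> poly (cost ?n) (length w) * (2 * B + 10)"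
  proof (cases "val ?zs i > 0")
    case True
    then show ?thesis using Upd.IH(1)[of l h ?zs k] Upd.prems zs by simp
  next
    case False
    then show ?thesis using Upd.IH(2)[of l h ?zs k] Upd.prems zs by simp
  qed
  then obtain t vs' where 3: "(istep D K ^^ t) (Code l ?n # k, ?T ?zs 0) = (k, ?T vs' 0)"
     "val vs' = sem w ?n (val ?zs)" "set vs' \<subseteq> digit_vectors K"
     "length vs' \<le> length ?zs + poly (cost ?n) (length w)"
     "t \<le> poly (cost ?n) (length w) * (2 * B + 10)"
    by blast
  let ?t = "Suc (Suc (length vs) + (Suc (length vs) + t))"
  have run: "(istep D K ^^ ?t) (Code l (Upd i s j c a b) # k, ?T vs 0) = (k, ?T vs' 0)"
    by (rule funpow_trans_Suc[OF 0 funpow_trans[OF 1 funpow_trans[OF 2 3(1)]]])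
  have cost: "poly (cost ?n) (length w) \<le> ?a + ?b" by simp
  then have "t \<le> (?a + ?b) * (2 * B + 10)" using 3(5) mult_le_mono1 order_trans by blast
  then have "?t \<le> poly (cost (Upd i s j c a b)) (length w) * (2 * B + 10)"
    using Upd.prems(5) by (simp add: algebra_simps)
  moreover have "val vs' = sem w (Upd i s j c a b) (val vs)"
    by (simp add: 3(2) val_sweep Let_def)
  moreover have "length vs' \<le> length vs + poly (cost (Upd i s j c a b)) (length w)"
    using 3(4) cost by simp
  ultimately show ?case using run 3(3) by blast
next
  case (For f)
  let ?N = "length w" and ?S = "\<Sum>a\<in>UNIV. poly (cost (f a)) (length w)"
  let ?T = "\<lambda>m vs. tapes D K w (h(l := int m)) vs 0"
  have l: "l < D" using For.prems(2) by simp
  have fa: "poly (cost (f a)) ?N \<le> ?S" for a by (rule member_le_sum) auto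
  \<comment> \<open>Arithmetic of one iteration, with variables in place of the polynomials:
    \<open>t\<close> steps for the body, \<open>u\<close> for the remaining iterations, one to enter
    and one to advance.\<close>
  have count: "Suc (t + Suc u) \<le> (2 + S) * Z + n * ((2 + S) * Z)"
    if "t \<le> S * Z" "u \<le> n * ((2 + S) * Z)" "2 \<le> Z" for t u n S Z :: nat
    using that by (simp add: add_mult_distrib)
  \<comment> \<open>The head of tape \<open>l\<close> has passed \<open>us\<close> and still has
    \<open>xs\<close> to read. This takes an induction of its own, since the program
    \<open>For f\<close> is the same in every iteration.\<close>
  have loop: "\<exists>t vs'. (istep D K ^^ t) (Code l (For f) # k, ?T (length us) vs) = (Code l (For f) # k, ?T ?N vs') \<and>
     val vs' = fold (\<lambda>a. sem w (f a)) xs (val vs) \<and> set vs' \<subseteq> digit_vectors K \<and>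
     length vs' \<le> length vs + length xs * ?S \<and>
     t \<le> length xs * ((2 + ?S) * (2 * B + 10))"
    if "w = us @ xs" "set vs \<subseteq> digit_vectors K" "length vs + length xs * ?S \<le> B" for us xs vs
    using that
  proof (induction xs arbitrary: us vs)
    case Nil
    then show ?case by (intro exI[of _ 0] exI[of _ vs]) simp
  next
    case (Cons x xs)
    let ?m = "length us"
    have hm: "read_tape (?T ?m vs l) = Letter x"
      using l input_tape_nth[of ?m w] Cons.prems(1) by (simp add: read_tapes)
    have 0: "istep D K (Code l (For f) # k, ?T ?m vs) =
      (Code (Suc l) (f x) # Advance l # Code l (For f) # k, ?T ?m vs)"
      by (rule istep_keep) (simp add: hm)
    have "\<exists>t vs'. (istep D K ^^ t) (Code (Suc l) (f x) # Advance l # Code l (For f) # k, ?T ?m vs) =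
        (Advance l # Code l (For f) # k, ?T ?m vs') \<and>
       val vs' = sem w (f x) (val vs) \<and> set vs' \<subseteq> digit_vectors K \<and>
       length vs' \<le> length vs + poly (cost (f x)) ?N \<and> t \<le> poly (cost (f x)) ?N * (2 * B + 10)"
      using For.prems For.IH num_regs_For[of f x] depth_For[of f x] fa[of x] Cons.prems
      by (intro For.IH) auto
    then obtain t vs' where 1: "(istep D K ^^ t) (Code (Suc l) (f x) # Advance l # Code l (For f) # k, ?T ?m vs) =
        (Advance l # Code l (For f) # k, ?T ?m vs')"
       "val vs' = sem w (f x) (val vs)" "set vs' \<subseteq> digit_vectors K"
       "length vs' \<le> length vs + poly (cost (f x)) ?N" "t \<le> poly (cost (f x)) ?N * (2 * B + 10)"
      by blast
    have "istep D K (Advance l # Code l (For f) # k, ?T ?m vs') = (Code l (For f) # k,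
        tapes D K w ((h(l := int ?m))(l := snd (act (read_tape (?T ?m vs' l), Right) (?T ?m vs' l)))) vs' 0)"
      by (rule istep_head[OF _ refl l]) simp
    then have 2: "istep D K (Advance l # Code l (For f) # k, ?T ?m vs') =
        (Code l (For f) # k, ?T (length (us @ [x])) vs')"
      using l by (simp add: tapes_def add.commute)
    have B': "length vs' + length xs * ?S \<le> B"
      using 1(4) fa[of x] Cons.prems(3) by simp
    obtain u vs'' where 3: "(istep D K ^^ u) (Code l (For f) # k, ?T (length (us @ [x])) vs') = (Code l (For f) # k, ?T ?N vs'')"
      "val vs'' = fold (\<lambda>a. sem w (f a)) xs (val vs')" "set vs'' \<subseteq> digit_vectors K"
      "length vs'' \<le> length vs' + length xs * ?S" "u \<le> length xs * ((2 + ?S) * (2 * B + 10))"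
      using Cons.IH[OF _ 1(3) B', of "us @ [x]"] Cons.prems(1) by fastforce
    have run: "(istep D K ^^ Suc (t + Suc u)) (Code l (For f) # k, ?T ?m vs) = (Code l (For f) # k, ?T ?N vs'')"
      by (rule funpow_trans_Suc[OF 0 funpow_trans[OF 1(1) funpow_trans_Suc[OF 2 3(1)]]])
    have "t \<le> ?S * (2 * B + 10)" using 1(5) fa[of x] mult_le_mono1 order_trans by blast
    then have "Suc (t + Suc u) \<le> (2 + ?S) * (2 * B + 10) + length xs * ((2 + ?S) * (2 * B + 10))"
      using 3(5) by (rule count) simp
    moreover have "length vs'' \<le> length vs + length (x # xs) * ?S"
      using 3(4) 1(4) fa[of x] by simp
    moreover have "val vs'' = fold (\<lambda>a. sem w (f a)) (x # xs) (val vs)"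
      using 3(2) 1(2) by simp
    ultimately show ?case using run 3(3)
      by (metis length_Cons mult_Suc)
  qed
  have h: "h(l := 0) = h" using For.prems(3) by auto
  have "?N * ?S \<le> ?N * (3 + ?S)" by simp
  then have "length vs + ?N * ?S \<le> B" using For.prems(5) by (simp only: cost_For)
  then obtain t vs' where 1: "(istep D K ^^ t) (Code l (For f) # k, tapes D K w h vs 0) = (Code l (For f) # k, ?T ?N vs')"
     "val vs' = fold (\<lambda>a. sem w (f a)) w (val vs)" "set vs' \<subseteq> digit_vectors K"
     "length vs' \<le> length vs + ?N * ?S" "t \<le> ?N * ((2 + ?S) * (2 * B + 10))"
    using loop[of "[]" w vs] For.prems(4) by (auto simp: h)
  have b: "read_tape (?T ?N vs' l) = Blank" using l by (simp add: read_tapes input_tape_blank)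
  have "istep D K (Code l (For f) # k, ?T ?N vs') =
      (Rewind l # k, tapes D K w ((h(l := int ?N))(l := snd (act (read_tape (?T ?N vs' l), Left) (?T ?N vs' l)))) vs' 0)"
    by (rule istep_head[OF _ refl l]) (simp add: b)
  then have 2: "istep D K (Code l (For f) # k, ?T ?N vs') =
      (Rewind l # k, tapes D K w (h(l := int ?N - 1)) vs' 0)"
    using l by (simp add: tapes_def)
  have 3: "(istep D K ^^ Suc ?N) (Rewind l # k, tapes D K w (h(l := int ?N - 1)) vs' 0) = (k, tapes D K w h vs' 0)"
    using rewind_run[OF order_refl l, of "h(l := int ?N - 1)" w K k vs'] by (simp add: h del: funpow.simps)
  let ?t = "t + Suc (Suc ?N)"
  have run: "(istep D K ^^ ?t) (Code l (For f) # k, tapes D K w h vs 0) = (k, tapes D K w h vs' 0)"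
    by (rule funpow_trans[OF 1(1) funpow_trans_Suc[OF 2 3]])
  have "?t \<le> (3 + ?N * (3 + ?S)) * (2 * B + 10)"
    using 1(5) by (simp add: algebra_simps)
  then show ?case
    using run 1(2,3,4) unfolding cost_For
    by (intro exI[of _ ?t] exI[of _ vs']) (simp add: add_mult_distrib2 del: funpow.simps)
qed

section \<open>Finitely many control stacks and tape symbols\<close>

definition sweeps :: "nat \<Rightarrow> int \<Rightarrow> nat \<Rightarrow> 'a item \<Rightarrow> 'a item \<Rightarrow> 'a item list \<Rightarrow> 'a item list set" where
  "sweeps i s j p q k =
     (\<lambda>(x, g). Sweep i s j x g p q # k) ` ({-1, 0, 1} \<times> {-1, 0, 1})"

text \<open>The stacks that can occur while \<open>c\<close> runs on top of \<open>k\<close>. A loop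
  body always runs on the same stack, from which the loop resumes, so the height does not depend on
  the number of iterations.\<close>

primrec controls :: "nat \<Rightarrow> 'a com \<Rightarrow> 'a item list \<Rightarrow> 'a item list set" where
  "controls l Skip k = {Code l Skip # k}"
| "controls l (Seq a b) k = insert (Code l (Seq a b) # k) (controls l a (Code l b # k) \<union> controls l b k)"
| "controls l (Upd i s j c a b) k =
     {Code l (Upd i s j c a b) # k, Return # Code l a # k, Return # Code l b # k} \<union>
     sweeps i (sgn s) j (Code l a) (Code l b) k \<union> controls l a k \<union> controls l b k"
| "controls l (For f) k =
     {Code l (For f) # k, Advance l # Code l (For f) # k, Rewind l # k} \<union>
     (\<Union>a. controls (Suc l) (f a) (Advance l # Code l (For f) # k))"

lemma finite_controls:
  fixes c :: "'a::finite com"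
  shows "finite (controls l c k)"
  by (induction c arbitrary: l k) (auto simp: sweeps_def)

lemma controls_start: "Code l c # k \<in> controls l c k"
  by (cases c) auto

lemma sgn_digit: "sgn x \<in> {-1, 0, 1::int}"
  by (auto simp: sgn_if)

lemma sign_from_digit: "g \<in> {-1, 0, 1} \<Longrightarrow> sign_from g x \<in> {-1, 0, 1}"
  by (auto simp: sign_from_def sgn_if)

lemma sweepsI: "x \<in> {-1, 0, 1} \<Longrightarrow> g \<in> {-1, 0, 1} \<Longrightarrow> Sweep i s j x g p q # k \<in> sweeps i s j p q k"
  by (force simp: sweeps_def)

lemma rule_sweeps:
  assumes "q \<in> sweeps i s j a b k"
  shows "fst (rule D K q X) \<in> sweeps i s j a b k \<union> {Return # a # k, Return # b # k, [Reject]}"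
proof -
  obtain c g where q: "q = Sweep i s j c g a b # k" "g \<in> {-1, 0, 1}"
    using assms by (auto simp: sweeps_def)
  show ?thesis
  proof (cases "X D")
    case (Aux m)
    define t where "t = from_nat_into (digit_vectors K) m i + s * from_nat_into (digit_vectors K) m j + c"
    have "fst (rule D K q X) = Sweep i s j (carry t) (sign_from g (t - 2 * carry t)) a b # k"
      by (simp add: q Aux Let_def t_def)
    then show ?thesis
      using sweepsI[OF carry_digit[of t] sign_from_digit[OF q(2), of "t - 2 * carry t"]] by simp
  qed (simp_all add: q)
qed

text \<open>Closure is needed for arbitrary readings \<open>X\<close>, as
  \<open>turing_machine\<close> demands it of \<open>delta\<close>. The only ways out are
  completion, which uncovers \<open>k\<close>, and the default \<open>[Reject]\<close>.\<close>

lemma controls_closed: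
  fixes c :: "'a::finite com"
  assumes "q \<in> controls l c k"
  shows "fst (rule D K q X) \<in> controls l c k \<union> {k, [Reject]}"
  using assms
proof (induction c arbitrary: l k)
  case Skip
  then show ?case by simp
next
  case (Seq a b)
  consider "q = Code l (Seq a b) # k" | "q \<in> controls l a (Code l b # k)" | "q \<in> controls l b k"
    using Seq.prems by auto
  then show ?case
  proof cases
    case 1
    then show ?thesis by (simp add: controls_start)
  next
    case 2
    then show ?thesis using Seq.IH(1)[of l "Code l b # k"] controls_start[of l b k] by auto
  next
    case 3
    then show ?thesis using Seq.IH(2)[of l k] by auto
  qed
next
  case (Upd i s j c a b)
  consider "q = Code l (Upd i s j c a b) # k" | "q = Return # Code l a # k" | "q = Return # Code l b # k"
    | "q \<in> sweeps i (sgn s) j (Code l a) (Code l b) k"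
    | "q \<in> controls l a k" | "q \<in> controls l b k"
    using Upd.prems by auto
  then show ?case
  proof cases
    case 1
    have "Sweep i (sgn s) j (sgn c) 0 (Code l a) (Code l b) # k \<in> sweeps i (sgn s) j (Code l a) (Code l b) k"
      by (rule sweepsI[OF sgn_digit]) simp
    then show ?thesis using 1 by simp
  next
    case 4
    then show ?thesis
      using rule_sweeps[OF 4, of D K X] by auto
  next
    case 5
    then show ?thesis using Upd.IH(1)[of l k] by auto
  next
    case 6
    then show ?thesis using Upd.IH(2)[of l k] by auto
  qed (use controls_start[of l a k] controls_start[of l b k] in auto)
next
  case (For f)
  consider "q = Code l (For f) # k" | "q = Advance l # Code l (For f) # k" | "q = Rewind l # k"
    | a where "q \<in> controls (Suc l) (f a) (Advance l # Code l (For f) # k)"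
    using For.prems by auto
  then show ?case
  proof cases
    case 1
    then show ?thesis using controls_start[of "Suc l"] by (cases "X l") auto
  next
    case 4
    then show ?thesis using For.IH[of "f a" "Suc l" "Advance l # Code l (For f) # k"] by auto
  qed auto
qed

text \<open>What a control must satisfy for its sweep to write only digit vectors; all other
  controls write symbols that they have just read.\<close>

fun sweep_ok :: "nat \<Rightarrow> 'a item list \<Rightarrow> bool" where
  "sweep_ok K (Sweep i s j c g p q # k) \<longleftrightarrow> i < K \<and> s \<in> {-1, 0, 1} \<and> c \<in> {-1, 0, 1}"
| "sweep_ok K q \<longleftrightarrow> True"

lemma controls_sweep_ok:
  fixes c :: "'a::finite com"
  assumes "num_regs c \<le> K" "q \<in> controls l c k"
  shows "sweep_ok K q"
  using assms
proof (induction c arbitrary: l k)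
  case (Upd i s j c a b)
  then show ?case using sgn_digit[of s] by (auto simp: sweeps_def)
next
  case (For f)
  then show ?case using num_regs_For[of f] order_trans by fastforce
qed auto

definition tape_symbols :: "nat \<Rightarrow> 'a symbol set" where
  "tape_symbols K = insert Blank (range Letter \<union> cell K ` digit_vectors K)"

lemma rule_symbols:
  fixes X :: "nat \<Rightarrow> 'a symbol"
  assumes "sweep_ok K q" "\<And>i. X i \<in> tape_symbols K"
  shows "fst (snd (rule D K q X) i) \<in> tape_symbols K"
proof (cases "\<exists>r s j c g a b k. q = Sweep r s j c g a b # k")
  case True
  then obtain r s j c g a b k where q: "q = Sweep r s j c g a b # k" by blast
  have ok: "r < K" "s \<in> {-1, 0, 1}" "c \<in> {-1, 0, 1}" using assms(1) by (auto simp: q)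
  have cell: "(cell K v :: 'a symbol) \<in> tape_symbols K" if "v \<in> digit_vectors K" for v :: "nat \<Rightarrow> int"
    using that by (simp add: tape_symbols_def)
  show ?thesis
  proof (cases "X D")
    case Blank
    then show ?thesis
      using assms(2) cell[OF update_digit_vectors[OF zero_digit_vectors ok(1,3)]]
      by (simp add: q keep_def)
  next
    case (Letter x)
    then show ?thesis using assms(2) by (simp add: q keep_def)
  next
    case (Aux m)
    then obtain v where v: "v \<in> digit_vectors K" "X D = cell K v"
      using assms(2)[of D] by (auto simp: tape_symbols_def)
    then have m: "from_nat_into (digit_vectors K) m = v"
      using Aux from_nat_into_cell by (simp add: cell_def)
    have "(cell K (v(r := v r + s * v j + c - 2 * carry (v r + s * v j + c))) :: 'a symbol) \<in> tape_symbols K"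
      by (intro cell update_digit_vectors v(1) ok carry_remainder digit_vectorsD[OF v(1)])
    then show ?thesis using assms(2) by (simp add: q keep_def Aux m Let_def)
  qed
next
  case False
  then show ?thesis
    using assms(2)[of i] assms(2)[of 0] assms(2)[of D] by (cases "(D, K, q, X)" rule: rule.cases) (auto simp: keep_def split: symbol.split)
qed

definition all_controls :: "'a com \<Rightarrow> 'a item list set" where
  "all_controls c =
     {[Copy, Code 0 c, Verdict], [CopyReturn, Code 0 c, Verdict], [Verdict], [Accept], [Reject]} \<union>
     {[Return, Accept], [Return, Reject]} \<union>
     sweeps 0 0 0 Accept Reject [] \<union>
     controls 0 c [Verdict]"

lemma all_controls_closed:
  fixes c :: "'a::finite com"
  assumes "q \<in> all_controls c"
  shows "fst (rule D K q X) \<in> all_controls c"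
proof -
  consider "q \<in> {[Copy, Code 0 c, Verdict], [CopyReturn, Code 0 c, Verdict], [Verdict], [Accept], [Reject]}"
    | "q \<in> {[Return, Accept], [Return, Reject]}"
    | "q \<in> sweeps 0 0 0 Accept Reject []"
    | "q \<in> controls 0 c [Verdict]"
    using assms by (auto simp: all_controls_def)
  then show ?thesis
  proof cases
    case 3
    then show ?thesis
      using rule_sweeps[OF 3, of D K X] by (auto simp: all_controls_def)
  next
    case 4
    then show ?thesis using controls_closed[OF 4, of D K X] by (auto simp: all_controls_def)
  qed (use controls_start[of 0 c "[Verdict]"] in \<open>auto simp: all_controls_def sweepsI\<close>)
qed

lemma finite_all_controls: "finite (all_controls (c :: 'a::finite com))"
  by (simp add: all_controls_def finite_controls sweeps_def)

lemma all_controls_sweep_ok: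
  fixes c :: "'a::finite com"
  shows "q \<in> all_controls c \<Longrightarrow> sweep_ok (Suc (num_regs c)) q"
  using controls_sweep_ok[of c "Suc (num_regs c)" q 0 "[Verdict]"]
  by (auto simp: all_controls_def sweeps_def)

section \<open>The Turing machine of a program and its running time\<close>

definition code :: "'a com \<Rightarrow> 'a item list \<Rightarrow> nat" where
  "code c = to_nat_on (all_controls c)"

text \<open>The work tape has number \<open>Suc (depth c)\<close>, so that it differs from the input
  tape even for a program without loops; \<open>Suc (num_regs c)\<close> tracks guarantee that
  register 0, tested by \<open>Verdict\<close>, exists.\<close>

definition machine :: "'a::finite com \<Rightarrow> 'a tm" where
  "machine c =
     \<lparr>num_tapes = Suc (Suc (depth c)), states = code c ` all_controls c,
      symbols = tape_symbols (Suc (num_regs c)),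
      start = code c [Copy, Code 0 c, Verdict], accept = code c [Accept], reject = code c [Reject],
      delta = (\<lambda>s xs. case rule (Suc (depth c)) (Suc (num_regs c)) (from_nat_into (all_controls c) s)
                (\<lambda>i. if i < length xs then xs ! i else Blank) of
              (q, A) \<Rightarrow> (code c q, map A [0..<Suc (Suc (depth c))]))\<rparr>"

lemma decode:
  "q \<in> all_controls (c :: 'a::finite com) \<Longrightarrow> from_nat_into (all_controls c) (code c q) = q"
  unfolding code_def using from_nat_into_to_nat_on[OF countable_finite[OF finite_all_controls]] .

lemma code_eq_iff:
  fixes c :: "'a::finite com"
  shows "q \<in> all_controls c \<Longrightarrow> q' \<in> all_controls c \<Longrightarrow> code c q = code c q' \<longleftrightarrow> q = q'"
  by (metis decode)

lemma turing_machine_machine: "turing_machine (machine (c :: 'a::finite com))"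
proof -
  let ?D = "Suc (depth c)" and ?K = "Suc (num_regs c)"
  have Q: "[Accept] \<in> all_controls c" "[Reject] \<in> all_controls c" "[Copy, Code 0 c, Verdict] \<in> all_controls c"
    by (auto simp: all_controls_def)
  have delta: "case delta (machine c) (code c q) xs of (s', as) \<Rightarrow>
      s' \<in> code c ` all_controls c \<and> length as = Suc ?D \<and> fst ` set as \<subseteq> tape_symbols ?K"
    if q: "q \<in> all_controls c" and xs: "set xs \<subseteq> tape_symbols ?K" for q xs
  proof -
    let ?X = "\<lambda>i. if i < length xs then xs ! i else Blank"
    have "?X i \<in> tape_symbols ?K" for i
      using xs nth_mem by (fastforce simp: tape_symbols_def)
    then have "fst (snd (rule ?D ?K q ?X) i) \<in> tape_symbols ?K" for i
      by (intro rule_symbols all_controls_sweep_ok q)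
    moreover have "fst (rule ?D ?K q ?X) \<in> all_controls c"
      by (rule all_controls_closed[OF q])
    ultimately show ?thesis
      by (auto simp: machine_def decode[OF q] split: prod.split)
  qed
  have sel: "num_tapes (machine c) = Suc ?D" "states (machine c) = code c ` all_controls c"
    "symbols (machine c) = tape_symbols ?K" "start (machine c) = code c [Copy, Code 0 c, Verdict]"
    "accept (machine c) = code c [Accept]" "reject (machine c) = code c [Reject]"
    by (simp_all add: machine_def)
  have "Blank \<in> tape_symbols ?K" "range Letter \<subseteq> tape_symbols ?K" "finite (tape_symbols ?K :: 'a symbol set)"
    by (auto simp: tape_symbols_def finite_digit_vectors)
  moreover have "\<forall>s \<in> code c ` all_controls c - {code c [Accept], code c [Reject]}. \<forall>xs.
      length xs = Suc ?D \<and> set xs \<subseteq> tape_symbols ?K \<longrightarrow>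
      (case delta (machine c) s xs of (s', as) \<Rightarrow>
        s' \<in> code c ` all_controls c \<and> length as = Suc ?D \<and> fst ` set as \<subseteq> tape_symbols ?K)"
  proof (intro ballI allI impI)
    fix s and xs :: "'a symbol list"
    assume "s \<in> code c ` all_controls c - {code c [Accept], code c [Reject]}"
      and xs: "length xs = Suc ?D \<and> set xs \<subseteq> tape_symbols ?K"
    then obtain q where "q \<in> all_controls c" "s = code c q" by blast
    then show "case delta (machine c) s xs of (s', as) \<Rightarrow>
        s' \<in> code c ` all_controls c \<and> length as = Suc ?D \<and> fst ` set as \<subseteq> tape_symbols ?K"
      using delta xs by simp
  qed
  moreover have "code c [Accept] \<noteq> code c [Reject]" using Q by (simp add: code_eq_iff)
  ultimately show ?thesis
    unfolding turing_machine_def sel using Q finite_imageI[OF finite_all_controls[of c], of "code c"]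
    by (intro conjI) auto
qed

definition conf :: "'a::finite com \<Rightarrow> 'a item list \<times> (nat \<Rightarrow> 'a tape) \<Rightarrow> 'a config" where
  "conf c x = (code c (fst x), map (snd x) [0..<Suc (Suc (depth c))])"

lemma map2_map: "map2 h (map f xs) (map g xs) = map (\<lambda>x. h (f x) (g x)) xs"
  by (induction xs) auto

text \<open>The machine sees the tapes up to the work tape and pads with \<open>Blank\<close>; as
  the further abstract tapes are blank, \<open>rule\<close> is given the same function. In halting
  states both sides stand still.\<close>

lemma step_conf:
  fixes c :: "'a::finite com"
  assumes "q \<in> all_controls c" "\<forall>i>Suc (depth c). T i = (\<lambda>_. Blank, 0)"
  shows "step (machine c) (conf c (q, T)) = conf c (istep (Suc (depth c)) (Suc (num_regs c)) (q, T))"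
proof -
  let ?D = "Suc (depth c)" and ?K = "Suc (num_regs c)"
  let ?X = "\<lambda>i. read_tape (T i)"
  obtain q' A where r: "rule ?D ?K q ?X = (q', A)" by fastforce
  have Q: "[Accept] \<in> all_controls c" "[Reject] \<in> all_controls c"
    by (auto simp: all_controls_def)
  show ?thesis
  proof (cases "q = [Accept] \<or> q = [Reject]")
    case True
    then have "istep ?D ?K (q, T) = (q, T)" by (auto intro: istep_keep)
    then show ?thesis using True by (auto simp: conf_def step_def machine_def)
  next
    case False
    let ?xs = "map read_tape (map T [0..<Suc ?D])"
    have X: "(\<lambda>i. if i < length ?xs then ?xs ! i else Blank) = ?X"
      using assms(2) by (auto simp: fun_eq_iff read_tape_def simp del: upt_Suc)
    have delta: "delta (machine c) (code c q) ?xs = (code c q', map A [0..<Suc ?D])"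
      by (simp only: machine_def tm.simps decode[OF assms(1)] X r prod.case)
    have halt: "code c q \<noteq> accept (machine c)" "code c q \<noteq> reject (machine c)"
      using False code_eq_iff[OF assms(1) Q(1)] code_eq_iff[OF assms(1) Q(2)] by (simp_all add: machine_def)
    have "step (machine c) (conf c (q, T)) = (code c q', map2 act (map A [0..<Suc ?D]) (map T [0..<Suc ?D]))"
      unfolding step_def conf_def by (simp only: fst_conv snd_conv prod.case delta halt simp_thms if_False)
    then show ?thesis
      by (simp add: map2_map conf_def istep_def r del: upt_Suc)
  qed
qed

lemma steps_conf:
  fixes c :: "'a::finite com"
  assumes "q \<in> all_controls c" "\<forall>i>Suc (depth c). T i = (\<lambda>_. Blank, 0)"
  shows "(step (machine c) ^^ t) (conf c (q, T)) =
    conf c ((istep (Suc (depth c)) (Suc (num_regs c)) ^^ t) (q, T))"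
  using assms
proof (induction t arbitrary: q T)
  case (Suc t)
  let ?D = "Suc (depth c)" and ?K = "Suc (num_regs c)"
  obtain q' T' where s: "istep ?D ?K (q, T) = (q', T')" by fastforce
  have "q' \<in> all_controls c"
    using all_controls_closed[OF Suc.prems(1), of ?D ?K "\<lambda>i. read_tape (T i)"] s
    by (auto simp: istep_def split: prod.splits)
  moreover have "\<forall>i>?D. T' i = (\<lambda>_. Blank, 0)"
    using s Suc.prems(2) by (auto simp: istep_def split: prod.splits)
  ultimately show ?case
    using Suc.IH[of q' T'] step_conf[OF Suc.prems] s by (simp add: funpow_Suc_right del: funpow.simps)
qed simp

lemma copy_run:
  assumes "D > 0"
  shows "(istep D K ^^ (2 * length w + 2)) (Copy # k, \<lambda>i. if i = 0 then input_tape w else input_tape [])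
     = (k, tapes D K w (\<lambda>_. 0) [] 0)"
proof -
  let ?N = "length w"
  \<comment> \<open>The configuration after copying \<open>m\<close> letters: tape 0 holds
    \<open>w\<close> throughout, the other copies hold a prefix, and all their heads are at
    \<open>m\<close>.\<close>
  define T where "T m = (\<lambda>i. if i < D then (fst (input_tape (if i = 0 then w else take m w)), int m)
      else (\<lambda>_. Blank, 0))" for m :: nat
  have read: "read_tape (T m 0) = fst (input_tape w) (int m)" for m
    using assms by (simp add: T_def read_tape_def)
  have written: "(fst (input_tape (take m w)))(int m := Letter (w ! m)) = fst (input_tape (take (Suc m) w))"
    if "m < ?N" for m
    using that by (auto simp: input_tape_def fun_eq_iff min_def)
  have copy: "(istep D K ^^ m) (Copy # k, T 0) = (Copy # k, T m)" if "m \<le> ?N" for m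
    using that
  proof (induction m)
    case (Suc m)
    then have "read_tape (T m 0) = Letter (w ! m)" by (simp add: read input_tape_nth)
    moreover have "act (Letter (w ! m), Right) (T m i) = T (Suc m) i" if "i < D" for i
      using that Suc.prems written[of m]
      by (auto simp: T_def act_def fun_upd_idem input_tape_nth)
    moreover have "T m i = T (Suc m) i" if "\<not> i < D" for i
      using that by (simp add: T_def)
    ultimately have "istep D K (Copy # k, T m) = (Copy # k, T (Suc m))"
      by (auto simp: istep_def fun_eq_iff)
    then show ?case using Suc by simp
  qed simp
  have tapes: "tapes D K w (\<lambda>_. z) [] 0 i = (if i < D then (fst (input_tape w), z) else (\<lambda>_. Blank, 0))"
    for z i by (auto simp: tapes_def work_def fun_eq_iff)
  have turn: "istep D K (Copy # k, T ?N) = (CopyReturn # k, tapes D K w (\<lambda>_. int ?N - 1) [] 0)"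
    using assms by (auto simp: istep_def fun_eq_iff read input_tape_blank tapes) (auto simp: T_def)
  have rewound: "(istep D K ^^ Suc m) (CopyReturn # k, tapes D K w (\<lambda>_. int m - 1) [] 0) = (k, tapes D K w (\<lambda>_. 0) [] 0)"
    if "m \<le> ?N" for m
    using that
  proof (induction m)
    case 0
    show ?case
      using assms by (auto simp: istep_def fun_eq_iff read_tape_def input_tape_blank tapes act_def)
  next
    case (Suc m)
    have "istep D K (CopyReturn # k, tapes D K w (\<lambda>_. int m) [] 0)
        = (CopyReturn # k, tapes D K w (\<lambda>_. int m - 1) [] 0)"
      using assms Suc.prems
      by (auto simp: istep_def fun_eq_iff read_tape_def input_tape_nth tapes act_def fun_upd_idem)
    then show ?case using Suc funpow_trans_Suc[OF _ Suc.IH] by (simp del: funpow.simps)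
  qed
  have T0: "(\<lambda>i. if i = 0 then input_tape w else input_tape []) = T 0"
    using assms by (auto simp: T_def fun_eq_iff input_tape_def)
  have "(istep D K ^^ (?N + Suc (Suc ?N))) (Copy # k, T 0) = (k, tapes D K w (\<lambda>_. 0) [] 0)"
    by (rule funpow_trans[OF copy funpow_trans_Suc[OF turn rewound]]) auto
  then show ?thesis by (simp add: T0 mult_2)
qed

theorem com_class_P:
  fixes c :: "'a::finite com"
  shows "{w. sem w c (\<lambda>_. 0) 0 > 0} \<in> class_P"
proof -
  let ?D = "Suc (depth c)" and ?K = "Suc (num_regs c)"
  \<comment> \<open>The summands pay for copying and returning, for the program (the work tape
    starts empty, so \<open>B\<close> is the cost itself), and for the final sweep with its
    return.\<close>
  define p where "p = [:2, 2:] + cost c * (2 * cost c + 10) + (2 * cost c + 4)"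
  have const: "poly (numeral n) x = (numeral n :: nat)" for n x
    by (metis of_nat_numeral poly_of_nat of_nat_id)
  have "decides_in_time (machine c) {w. sem w c (\<lambda>_. 0) 0 > 0} (poly p)"
    unfolding decides_in_time_def
  proof
    fix w :: "'a list"
    let ?C = "poly (cost c) (length w)"
    let ?T = "\<lambda>i. if i = 0 then input_tape w else input_tape []"
    let ?q = "[Copy, Code 0 c, Verdict]"
    have 1: "(istep ?D ?K ^^ (2 * length w + 2)) (?q, ?T) = ([Code 0 c, Verdict], tapes ?D ?K w (\<lambda>_. 0) [] 0)"
      by (rule copy_run) simp
    have v0: "val [] = (\<lambda>_. 0)" by (rule ext) simp
    obtain t vs where 2: "(istep ?D ?K ^^ t) ([Code 0 c, Verdict], tapes ?D ?K w (\<lambda>_. 0) [] 0)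
        = ([Verdict], tapes ?D ?K w (\<lambda>_. 0) vs 0)"
      "val vs = sem w c (\<lambda>_. 0)" "set vs \<subseteq> digit_vectors ?K" "length vs \<le> ?C" "t \<le> ?C * (2 * ?C + 10)"
      using com_run[of c ?K 0 ?D "\<lambda>_. 0" "[]" w ?C "[Verdict]"] by (auto simp: v0)
    let ?vs = "sweep 0 0 0 0 vs"
    let ?v = "if val ?vs 0 > 0 then Accept else Reject"
    have 3: "istep ?D ?K ([Verdict], tapes ?D ?K w (\<lambda>_. 0) vs 0) =
        ([Sweep 0 0 0 0 0 Accept Reject], tapes ?D ?K w (\<lambda>_. 0) vs 0)"
      by (simp add: istep_keep)
    have "sign_from 0 x > 0 \<longleftrightarrow> x > 0" for x by (auto simp: sign_from_def sgn_if)
    then have 4: "(istep ?D ?K ^^ Suc (length vs)) ([Sweep 0 0 0 0 0 Accept Reject], tapes ?D ?K w (\<lambda>_. 0) vs 0)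
       = ([Return, ?v], tapes ?D ?K w (\<lambda>_. 0) ?vs (int (length vs) - 1))"
      using sweep_run[OF 2(3), of 0 0 0 ?D 0 0 Accept Reject "[]" w "\<lambda>_. 0" "[]"]
      by (simp del: funpow.simps)
    have 5: "(istep ?D ?K ^^ Suc (length vs)) ([Return, ?v], tapes ?D ?K w (\<lambda>_. 0) ?vs (int (length vs) - 1))
       = ([?v], tapes ?D ?K w (\<lambda>_. 0) ?vs 0)"
      by (rule return_run) simp
    let ?t = "2 * length w + 2 + (t + Suc (Suc (length vs) + Suc (length vs)))"
    have run: "(istep ?D ?K ^^ ?t) (?q, ?T) = ([?v], tapes ?D ?K w (\<lambda>_. 0) ?vs 0)"
      by (rule funpow_trans[OF 1 funpow_trans[OF 2(1) funpow_trans_Suc[OF 3 funpow_trans[OF 4 5]]]])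
    have init: "init (machine c) w = conf c (?q, ?T)"
      by (simp add: init_def conf_def machine_def map_replicate_const[symmetric] upt_conv_Cons del: upt_Suc replicate.simps)
         (simp add: list_eq_iff_nth_eq nth_Cons' del: upt_Suc replicate.simps)
    have "(step (machine c) ^^ ?t) (init (machine c) w) = conf c ([?v], tapes ?D ?K w (\<lambda>_. 0) ?vs 0)"
      unfolding init run[symmetric]
      by (rule steps_conf) (auto simp: all_controls_def input_tape_def)
    then have "fst ((step (machine c) ^^ ?t) (init (machine c) w)) =
        (if w \<in> {w. sem w c (\<lambda>_. 0) 0 > 0} then accept (machine c) else reject (machine c))"
      by (simp add: conf_def machine_def val_sweep 2(2))
    moreover have "?t \<le> poly p (length w)"
      using 2(4,5) by (simp add: p_def const)
    ultimately show "\<exists>t\<le>poly p (length w). fst ((step (machine c) ^^ t) (init (machine c) w)) =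
        (if w \<in> {w. sem w c (\<lambda>_. 0) 0 > 0} then accept (machine c) else reject (machine c))"
      by blast
  qed
  then show ?thesis
    unfolding class_P_def using turing_machine_machine by blast
qed


section \<open>Functions computed by programs\<close>

text \<open>A value occupies a number of registers fixed by its type. Tuples of numbers suffice as
  loop states because all longer data is reread from the input.\<close>

class ints =
  fixes arity :: "'a itself \<Rightarrow> nat"
    and enc :: "'a \<Rightarrow> nat \<Rightarrow> int"

instantiation int :: ints
begin
definition arity_int :: "int itself \<Rightarrow> nat" where "arity_int _ = 1"
definition enc_int :: "int \<Rightarrow> nat \<Rightarrow> int" where "enc_int x i = x"
instance ..
end

instantiation bool :: ints
begin
definition arity_bool :: "bool itself \<Rightarrow> nat" where "arity_bool _ = 1"
definition enc_bool :: "bool \<Rightarrow> nat \<Rightarrow> int" where "enc_bool x i = of_bool x"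
instance ..
end

instantiation unit :: ints
begin
definition arity_unit :: "unit itself \<Rightarrow> nat" where "arity_unit _ = 0"
definition enc_unit :: "unit \<Rightarrow> nat \<Rightarrow> int" where "enc_unit x i = 0"
instance ..
end

instantiation prod :: (ints, ints) ints
begin
definition arity_prod :: "('a \<times> 'b) itself \<Rightarrow> nat" where
  "arity_prod _ = arity TYPE('a) + arity TYPE('b)"
definition enc_prod :: "'a \<times> 'b \<Rightarrow> nat \<Rightarrow> int" where
  "enc_prod x i = (if i < arity TYPE('a) then enc (fst x) i else enc (snd x) (i - arity TYPE('a)))"
instance ..
end

text \<open>
  The argument \<open>x\<close> is held by the registers \<open>\<rho> 0, \<rho> 1, \<dots>\<close>, all below \<open>k\<close>. A program computes a
  component of the value into register \<open>k\<close> and leaves all registers below \<open>k\<close> unchanged.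
\<close>

definition held :: "(nat \<Rightarrow> nat) \<Rightarrow> 'x::ints \<Rightarrow> (nat \<Rightarrow> int) \<Rightarrow> bool" where
  "held \<rho> x R \<longleftrightarrow> (\<forall>j<arity TYPE('x). R (\<rho> j) = enc x j)"

definition below :: "'x::ints itself \<Rightarrow> (nat \<Rightarrow> nat) \<Rightarrow> nat \<Rightarrow> bool" where
  "below _ \<rho> k \<longleftrightarrow> (\<forall>j<arity TYPE('x). \<rho> j < k)"

definition agree :: "nat \<Rightarrow> (nat \<Rightarrow> int) \<Rightarrow> (nat \<Rightarrow> int) \<Rightarrow> bool" where
  "agree k R R' \<longleftrightarrow> (\<forall>j<k. R' j = R j)"

definition computes :: "'a com \<Rightarrow> (nat \<Rightarrow> nat) \<Rightarrow> nat \<Rightarrow> ('a list \<Rightarrow> 'x::ints \<Rightarrow> int) \<Rightarrow> bool" where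
  "computes c \<rho> k f \<longleftrightarrow>
     (\<forall>w x R. held \<rho> x R \<longrightarrow> agree k R (sem w c R) \<and> sem w c R k = f w x)"

text \<open>Asking for one component at a time and for every placement \<open>\<rho>\<close> makes
  pairing and projections free: nothing has to be moved. Registers from \<open>k\<close> on are
  scratch space with unknown contents.\<close>

definition computable :: "('a list \<Rightarrow> 'x::ints \<Rightarrow> 'y::ints) \<Rightarrow> bool" where
  "computable F \<longleftrightarrow> (\<forall>\<rho> k i. below TYPE('x) \<rho> k \<longrightarrow> i < arity TYPE('y) \<longrightarrow>
     (\<exists>c. computes c \<rho> k (\<lambda>w x. enc (F w x) i)))"

named_theorems computable_intros

lemma held_agree: "held \<rho> (x :: 'x::ints) R \<Longrightarrow> below TYPE('x) \<rho> k \<Longrightarrow> agree k R R' \<Longrightarrow> held \<rho> x R'"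
  by (simp add: held_def below_def agree_def)

lemma agree_refl [simp]: "agree k R R"
  by (simp add: agree_def)

lemma agree_trans: "agree k R R' \<Longrightarrow> agree k R' R'' \<Longrightarrow> agree k R R''"
  by (simp add: agree_def)

lemma agree_mono: "agree l R R' \<Longrightarrow> k \<le> l \<Longrightarrow> agree k R R'"
  by (simp add: agree_def)

lemma agree_upd: "agree k R (R'(j := y)) \<longleftrightarrow> agree k R R'" if "k \<le> j"
  using that by (auto simp: agree_def)

lemma below_mono: "below TYPE('x::ints) \<rho> k \<Longrightarrow> k \<le> l \<Longrightarrow> below TYPE('x) \<rho> l"
  unfolding below_def using less_le_trans by blast

section \<open>Programs for the basic operations\<close>

definition assign :: "nat \<Rightarrow> int \<Rightarrow> nat \<Rightarrow> int \<Rightarrow> 'a com" where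
  "assign i s j c = Upd i s j c Skip Skip"

lemma sem_assign [simp]: "sem w (assign i s j c) R = R(i := R i + sgn s * R j + sgn c)"
  by (simp add: assign_def Let_def)

definition clear :: "nat \<Rightarrow> 'a com" where
  "clear i = assign i (-1) i 0"

lemma sem_clear [simp]: "sem w (clear i) R = R(i := 0)"
  by (simp add: clear_def)

definition move :: "nat \<Rightarrow> nat \<Rightarrow> 'a com" where
  "move i j = (if i = j then Skip else Seq (clear i) (assign i 1 j 0))"

lemma sem_move [simp]: "sem w (move i j) R = R(i := R j)"
  by (simp add: move_def)

lemma computable_id [computable_intros]: "computable (\<lambda>w x. x)"
  unfolding computable_def
proof (intro allI impI)
  fix \<rho> k i assume "below TYPE('b) \<rho> k" and "i < arity TYPE('b)"
  then have "computes (move k (\<rho> i)) \<rho> k (\<lambda>w (x::'b). enc x i)"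
    by (simp add: computes_def agree_upd held_def)
  then show "\<exists>c. computes c \<rho> k (\<lambda>w (x::'b). enc x i)" by blast
qed

lemma computable_const [computable_intros]: "computable (\<lambda>w x. y)"
proof -
  have "\<exists>c::'a com. \<forall>w R. sem w c R = R(k := R k + sgn s * int n)" for k s n
  proof (induction n)
    case 0
    then show ?case by (intro exI[of _ Skip]) simp
  next
    case (Suc n)
    then obtain c :: "'a com" where "\<And>w R. sem w c R = R(k := R k + sgn s * int n)" by blast
    then show ?case by (intro exI[of _ "Seq c (assign k 0 k s)"]) (simp add: algebra_simps)
  qed
  then have "\<exists>c::'a com. \<forall>w R. sem w c R = R(k := v)" for k v
  proof -
    obtain c :: "'a com" where "\<And>w R. sem w c R = R(k := R k + sgn v * int (nat \<bar>v\<bar>))"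
      using \<open>\<And>s n k. \<exists>c::'a com. \<forall>w R. sem w c R = R(k := R k + sgn s * int n)\<close> by blast
    then show ?thesis by (intro exI[of _ "Seq (clear k) c"]) (simp add: sgn_mult_abs)
  qed
  then show ?thesis
    unfolding computable_def computes_def by (metis agree_refl agree_upd fun_upd_same order_refl)
qed

lemma computable_pair [computable_intros]:
  assumes "computable F" "computable G"
  shows "computable (\<lambda>w x. (F w x, G w x))"
  unfolding computable_def
proof (intro allI impI)
  fix \<rho> k i assume k: "below TYPE('b) \<rho> k" and i: "i < arity TYPE('c \<times> 'd)"
  show "\<exists>c. computes c \<rho> k (\<lambda>w x. enc (F w x, G w x) i)"
  proof (cases "i < arity TYPE('c)")
    case True
    then show ?thesis using assms(1) k by (simp add: computable_def enc_prod_def)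
  next
    case False
    then have "i - arity TYPE('c) < arity TYPE('d)" using i by (simp add: arity_prod_def)
    then show ?thesis using assms(2) k False by (simp add: computable_def enc_prod_def)
  qed
qed

lemma computable_fst [computable_intros]:
  assumes "computable F"
  shows "computable (\<lambda>w x. fst (F w x))"
  unfolding computable_def
proof (intro allI impI)
  fix \<rho> k i assume k: "below TYPE('b) \<rho> k" and i: "i < arity TYPE('c)"
  have "\<exists>c. computes c \<rho> k (\<lambda>w x. enc (F w x) i)"
    using assms k i unfolding computable_def by (auto simp: arity_prod_def)
  then show "\<exists>c. computes c \<rho> k (\<lambda>w x. enc (fst (F w x)) i)"
    using i by (simp add: enc_prod_def)
qed

lemma computable_snd [computable_intros]:
  fixes F :: "'a list \<Rightarrow> 'b::ints \<Rightarrow> 'c::ints \<times> 'd::ints"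
  assumes "computable F"
  shows "computable (\<lambda>w x. snd (F w x))"
  unfolding computable_def
proof (intro allI impI)
  fix \<rho> k i assume k: "below TYPE('b) \<rho> k" and i: "i < arity TYPE('d)"
  have "\<exists>c. computes c \<rho> k (\<lambda>w x. enc (F w x) (arity TYPE('c) + i))"
    using assms k i unfolding computable_def by (auto simp: arity_prod_def)
  then show "\<exists>c. computes c \<rho> k (\<lambda>w x. enc (snd (F w x)) i)"
    using i by (simp add: enc_prod_def)
qed

lemma computable_all_components:
  fixes F :: "'a list \<Rightarrow> 'x::ints \<Rightarrow> 'y::ints"
  assumes "computable F" "below TYPE('x) \<rho> k"
  obtains c where "\<And>w (x :: 'x) R. held \<rho> x R \<Longrightarrow> agree k R (sem w c R)"
    "\<And>w x R i. held \<rho> x R \<Longrightarrow> i < arity TYPE('y) \<Longrightarrow> sem w c R (k + i) = enc (F w x) i"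
proof -
  have "\<exists>c. \<forall>w x R. held \<rho> x R \<longrightarrow> agree k R (sem w c R) \<and>
      (\<forall>i<n. sem w c R (k + i) = enc (F w x) i)" if "n \<le> arity TYPE('y)" for n
    using that
  proof (induction n)
    case 0
    then show ?case by (intro exI[of _ Skip]) simp
  next
    case (Suc n)
    then obtain c where c: "\<And>w x R. held \<rho> x R \<Longrightarrow> agree k R (sem w c R) \<and>
      (\<forall>i<n. sem w c R (k + i) = enc (F w x) i)" by auto
    \<comment> \<open>Component \<open>n\<close> is computed with base \<open>k + n\<close>, above
      the components already stored, which it therefore leaves intact.\<close>
    have b: "below TYPE('x) \<rho> (k + n)" by (rule below_mono[OF assms(2)]) simp
    then obtain d where d: "computes d \<rho> (k + n) (\<lambda>w x. enc (F w x) n)"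
      using assms(1) Suc.prems unfolding computable_def by (meson Suc_le_lessD)
    have "agree k R (sem w (Seq c d) R) \<and> (\<forall>i<Suc n. sem w (Seq c d) R (k + i) = enc (F w x) i)"
      if "held \<rho> x R" for w x R
    proof -
      have "held \<rho> x (sem w c R)" using held_agree[OF that assms(2)] c[OF that] by blast
      then have 1: "agree (k + n) (sem w c R) (sem w d (sem w c R))"
          "sem w d (sem w c R) (k + n) = enc (F w x) n"
        using d by (auto simp: computes_def)
      then show ?thesis
        using c[OF that, of w] agree_mono[OF 1(1), of k] by (auto simp: less_Suc_eq agree_def)
    qed
    then show ?case by blast
  qed
  from this[OF order_refl] obtain c where "\<forall>w x R. held \<rho> x R \<longrightarrow> agree k R (sem w c R) \<and>
      (\<forall>i<arity TYPE('y). sem w c R (k + i) = enc (F w x) i)" by blast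
  then show thesis by (intro that[of c]) blast+
qed

lemma computable_comp:
  fixes F :: "'a list \<Rightarrow> 'x::ints \<Rightarrow> 'y::ints" and G :: "'a list \<Rightarrow> 'y \<Rightarrow> 'z::ints"
  assumes "computable F" "computable G"
  shows "computable (\<lambda>w x. G w (F w x))"
  unfolding computable_def
proof (intro allI impI)
  fix \<rho> k i assume k: "below TYPE('x) \<rho> k" and i: "i < arity TYPE('z)"
  let ?n = "arity TYPE('y)"
  obtain c where c: "\<And>w (x :: 'x) R. held \<rho> x R \<Longrightarrow> agree k R (sem w c R)"
    "\<And>w x R i. held \<rho> x R \<Longrightarrow> i < ?n \<Longrightarrow> sem w c R (k + i) = enc (F w x) i"
    using computable_all_components[OF assms(1) k] by blast
  have "below TYPE('y) (\<lambda>j. k + j) (k + ?n)" by (simp add: below_def)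
  then obtain d where d: "computes d (\<lambda>j. k + j) (k + ?n) (\<lambda>w y. enc (G w y) i)"
    using assms(2) i unfolding computable_def by blast
  have "computes (Seq (Seq c d) (move k (k + ?n))) \<rho> k (\<lambda>w x. enc (G w (F w x)) i)"
    unfolding computes_def
  proof (intro allI impI)
    fix w x R assume h: "held \<rho> (x :: 'x) R"
    have "held (\<lambda>j. k + j) (F w x) (sem w c R)" using c(2)[OF h] by (simp add: held_def)
    then have "agree (k + ?n) (sem w c R) (sem w d (sem w c R))"
        "sem w d (sem w c R) (k + ?n) = enc (G w (F w x)) i"
      using d by (auto simp: computes_def)
    then show "agree k R (sem w (Seq (Seq c d) (move k (k + ?n))) R) \<and>
        sem w (Seq (Seq c d) (move k (k + ?n))) R k = enc (G w (F w x)) i"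
      using agree_trans[OF c(1)[OF h] agree_mono] by (simp add: agree_upd)
  qed
  then show "\<exists>c. computes c \<rho> k (\<lambda>w x. enc (G w (F w x)) i)" by blast
qed

lemma computable_intD:
  fixes F :: "'a list \<Rightarrow> 'x::ints \<Rightarrow> int"
  assumes "computable F" "below TYPE('x) \<rho> k"
  obtains c where "computes c \<rho> k F"
  using assms unfolding computable_def by (auto simp: arity_int_def enc_int_def)

lemma computable_intI:
  fixes F :: "'a list \<Rightarrow> 'x::ints \<Rightarrow> int"
  assumes "\<And>\<rho> k. below TYPE('x) \<rho> k \<Longrightarrow> \<exists>c. computes c \<rho> k F"
  shows "computable F"
  using assms unfolding computable_def by (auto simp: arity_int_def enc_int_def)

lemma computable_boolD:
  fixes F :: "'a list \<Rightarrow> 'x::ints \<Rightarrow> bool"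
  assumes "computable F" "below TYPE('x) \<rho> k"
  obtains c where "computes c \<rho> k (\<lambda>w x. of_bool (F w x))"
  using assms unfolding computable_def by (auto simp: arity_bool_def enc_bool_def)

lemma computes_Seq:
  fixes F G :: "'a list \<Rightarrow> 'x::ints \<Rightarrow> int"
  assumes "below TYPE('x) \<rho> k" "computes c \<rho> k F" "computes d \<rho> (Suc k) G" "held \<rho> x R"
  shows "agree k R (sem w (Seq c d) R)" "sem w (Seq c d) R k = F w x" "sem w (Seq c d) R (Suc k) = G w x"
proof -
  have c: "agree k R (sem w c R)" "sem w c R k = F w x"
    using assms(2,4) by (auto simp: computes_def)
  have "held \<rho> x (sem w c R)" using held_agree[OF assms(4,1) c(1)] .
  then have d: "agree (Suc k) (sem w c R) (sem w d (sem w c R))" "sem w d (sem w c R) (Suc k) = G w x"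
    using assms(3) by (auto simp: computes_def)
  show "agree k R (sem w (Seq c d) R)" using agree_trans[OF c(1) agree_mono[OF d(1)]] by simp
  show "sem w (Seq c d) R k = F w x" using c(2) d(1) by (simp add: agree_def)
  show "sem w (Seq c d) R (Suc k) = G w x" using d(2) by simp
qed

lemma computable_linear:
  fixes F G :: "'a list \<Rightarrow> 'x::ints \<Rightarrow> int"
  assumes "computable F" "computable G"
  shows "computable (\<lambda>w x. F w x + sgn s * G w x)"
proof (rule computable_intI)
  fix \<rho> k assume k: "below TYPE('x) \<rho> k"
  obtain c where c: "computes c \<rho> k F" using computable_intD[OF assms(1) k] .
  obtain d where d: "computes d \<rho> (Suc k) G" using computable_intD[OF assms(2) below_mono[OF k, of "Suc k"]] by auto
  show "\<exists>c. computes c \<rho> k (\<lambda>w x. F w x + sgn s * G w x)"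
    using computes_Seq[OF k c d]
    by (intro exI[of _ "Seq (Seq c d) (assign k s (Suc k) 0)"]) (auto simp: computes_def agree_upd)
qed

lemma computable_add [computable_intros]: "computable F \<Longrightarrow> computable G \<Longrightarrow> computable (\<lambda>w x. F w x + G w x :: int)"
  using computable_linear[of F G 1] by simp

lemma computable_diff [computable_intros]: "computable F \<Longrightarrow> computable G \<Longrightarrow> computable (\<lambda>w x. F w x - G w x :: int)"
  using computable_linear[of F G "-1"] by simp

lemma computable_uminus [computable_intros]: "computable F \<Longrightarrow> computable (\<lambda>w x. - F w x :: int)"
  using computable_diff[OF computable_const[of 0], of F] by simp

lemma computable_double [computable_intros]: "computable F \<Longrightarrow> computable (\<lambda>w x. 2 * F w x :: int)"
  unfolding mult_2 by (rule computable_add)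

lemma computable_if [computable_intros]:
  fixes F G :: "'a list \<Rightarrow> 'x::ints \<Rightarrow> 'y::ints"
  assumes "computable B" "computable F" "computable G"
  shows "computable (\<lambda>w x. if B w x then F w x else G w x)"
  unfolding computable_def
proof (intro allI impI)
  fix \<rho> k i assume k: "below TYPE('x) \<rho> k" and i: "i < arity TYPE('y)"
  obtain b where b: "computes b \<rho> k (\<lambda>w x. of_bool (B w x))" using computable_boolD[OF assms(1) k] .
  obtain c where c: "computes c \<rho> k (\<lambda>w x. enc (F w x) i)" using assms(2) k i unfolding computable_def by blast
  obtain d where d: "computes d \<rho> k (\<lambda>w x. enc (G w x) i)" using assms(3) k i unfolding computable_def by blast
  \<comment> \<open>\<open>Upd k 0 k 0\<close> changes nothing and only tests register
    \<open>k\<close>; either branch then overwrites the condition with the result.\<close>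
  have "computes (Seq b (Upd k 0 k 0 c d)) \<rho> k (\<lambda>w x. enc (if B w x then F w x else G w x) i)"
    unfolding computes_def
  proof (intro allI impI)
    fix w x R assume h: "held \<rho> (x :: 'x) R"
    have b: "agree k R (sem w b R)" "sem w b R k = of_bool (B w x)"
      using b h by (auto simp: computes_def)
    then have "held \<rho> x (sem w b R)" using held_agree[OF h k] by blast
    then have cd: "agree k (sem w b R) (sem w c (sem w b R))" "sem w c (sem w b R) k = enc (F w x) i"
        "agree k (sem w b R) (sem w d (sem w b R))" "sem w d (sem w b R) k = enc (G w x) i"
      using c d by (auto simp: computes_def)
    then show "agree k R (sem w (Seq b (Upd k 0 k 0 c d)) R) \<and>
        sem w (Seq b (Upd k 0 k 0 c d)) R k = enc (if B w x then F w x else G w x) i"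
      using b(2) cd agree_trans[OF b(1) cd(1)] agree_trans[OF b(1) cd(3)] 
        fun_upd_idem[of "sem w b R" k, OF b(2)]
      by (cases "B w x") simp_all
  qed
  then show "\<exists>c. computes c \<rho> k (\<lambda>w x. enc (if B w x then F w x else G w x) i)" by blast
qed

lemma computable_positive:
  fixes F :: "'a list \<Rightarrow> 'x::ints \<Rightarrow> int"
  assumes "computable F"
  shows "computable (\<lambda>w x. 0 < F w x)"
  unfolding computable_def
proof (intro allI impI)
  fix \<rho> k i assume k: "below TYPE('x) \<rho> k" and i: "i < arity TYPE(bool)"
  obtain c where c: "computes c \<rho> k F" using computable_intD[OF assms k] .
  have "computes (Seq c (Upd k 0 k 0 (Seq (clear k) (assign k 0 k 1)) (clear k))) \<rho> k
      (\<lambda>w x. enc (0 < F w x) i)"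
    using c by (auto simp: computes_def enc_bool_def agree_upd)
  then show "\<exists>c. computes c \<rho> k (\<lambda>w x. enc (0 < F w x) i)" by blast
qed

lemma computable_less [computable_intros]: "computable F \<Longrightarrow> computable G \<Longrightarrow> computable (\<lambda>w x. F w x < (G w x :: int))"
  using computable_positive[OF computable_diff[of G F]] by simp

lemma computable_not [computable_intros]:
  assumes "computable F"
  shows "computable (\<lambda>w x. \<not> F w x)"
proof -
  have "computable (\<lambda>w x. if F w x then False else True)" by (intro computable_intros assms)
  then show ?thesis by (rule back_subst[of computable]) (auto simp: fun_eq_iff)
qed

lemma computable_conj [computable_intros]:
  assumes "computable F" "computable G"
  shows "computable (\<lambda>w x. F w x \<and> G w x)"
proof -
  have "computable (\<lambda>w x. if F w x then G w x else False)" by (intro computable_intros assms)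
  then show ?thesis by (rule back_subst[of computable]) (auto simp: fun_eq_iff)
qed

lemma computable_disj [computable_intros]:
  assumes "computable F" "computable G"
  shows "computable (\<lambda>w x. F w x \<or> G w x)"
proof -
  have "computable (\<lambda>w x. \<not> (\<not> F w x \<and> \<not> G w x))" by (intro computable_intros assms)
  then show ?thesis by (rule back_subst[of computable]) (auto simp: fun_eq_iff)
qed

lemma computable_le [computable_intros]: "computable F \<Longrightarrow> computable G \<Longrightarrow> computable (\<lambda>w x. F w x \<le> (G w x :: int))"
  using computable_not[OF computable_less[of G F]] by (simp add: not_less)

lemma computable_eq [computable_intros]:
  assumes "computable F" "computable G"
  shows "computable (\<lambda>w x. F w x = (G w x :: int))"
proof -
  have "computable (\<lambda>w x. F w x \<le> G w x \<and> G w x \<le> F w x)" by (intro computable_intros assms)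
  then show ?thesis by (rule back_subst[of computable]) (auto simp: fun_eq_iff)
qed

lemma computable_abs [computable_intros]:
  assumes "computable F"
  shows "computable (\<lambda>w x. \<bar>F w x :: int\<bar>)"
  unfolding abs_if by (intro computable_intros assms)

text \<open>Used with \<open>m = n\<close> to move a new loop state over the old one: a new
  component may depend on all old ones, so none is overwritten before all are known. For
  \<open>m \<le> n\<close> every source lies above the targets already written.\<close>

lemma shift_down:
  "\<exists>c::'a com. \<forall>w R. sem w c R = (\<lambda>j. if k \<le> j \<and> j < k + m then R (j + n) else R j)" if "m \<le> n"
  using that
proof (induction m)
  case 0
  then show ?case by (intro exI[of _ Skip]) auto
next
  case (Suc m)
  then obtain c :: "'a com" where "\<And>w R. sem w c R = (\<lambda>j. if k \<le> j \<and> j < k + m then R (j + n) else R j)" by auto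
  then show ?case
    using Suc.prems by (intro exI[of _ "Seq c (move (k + m) (k + m + n))"]) (auto simp: fun_eq_iff)
qed

lemma computable_fold:
  fixes S :: "'a list \<Rightarrow> 'x::ints \<Rightarrow> 's::ints"
  assumes "computable S" "\<And>a. computable (\<lambda>w p. G a w (fst p) (snd p))"
  shows "computable (\<lambda>w x. fold (\<lambda>a. G a w x) w (S w x))"
  unfolding computable_def
proof (intro allI impI)
  fix \<rho> k i assume k: "below TYPE('x) \<rho> k" and i: "i < arity TYPE('s)"
  let ?n = "arity TYPE('s)" and ?m = "arity TYPE('x)"
  obtain c where c: "\<And>w (x :: 'x) R. held \<rho> x R \<Longrightarrow> agree k R (sem w c R)"
    "\<And>w x R i. held \<rho> x R \<Longrightarrow> i < ?n \<Longrightarrow> sem w c R (k + i) = enc (S w x) i"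
    using computable_all_components[OF assms(1) k] by blast
  \<comment> \<open>The argument stays in place and the state occupies the registers from
    \<open>k\<close> on, so their pair needs a composite placement.\<close>
  define \<rho>' where "\<rho>' j = (if j < ?m then \<rho> j else k + (j - ?m))" for j
  have b: "below TYPE('x \<times> 's) \<rho>' (k + ?n)"
    using k by (auto simp: below_def \<rho>'_def arity_prod_def trans_less_add1)
  have "\<exists>d. \<forall>w p R. held \<rho>' p R \<longrightarrow> agree (k + ?n) R (sem w d R) \<and>
      (\<forall>i<?n. sem w d R (k + ?n + i) = enc (G a w (fst p) (snd p)) i)" for a
    using computable_all_components[OF assms(2) b, of a] by metis
  then obtain d where d: "\<And>a w p R. held \<rho>' p R \<Longrightarrow> agree (k + ?n) R (sem w (d a) R) \<and>
      (\<forall>i<?n. sem w (d a) R (k + ?n + i) = enc (G a w (fst p) (snd p)) i)"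
    by metis
  obtain e :: "'a com" where e: "\<And>w R. sem w e R = (\<lambda>j. if k \<le> j \<and> j < k + ?n then R (j + ?n) else R j)"
    using shift_down[of ?n ?n k] by auto
  let ?f = "\<lambda>a. Seq (d a) e"
  have loop: "agree k R (fold (\<lambda>a. sem w (?f a)) xs R) \<and>
      (\<forall>i<?n. fold (\<lambda>a. sem w (?f a)) xs R (k + i) = enc (fold (\<lambda>a. G a w x) xs s) i)"
    if "held \<rho> x R" "\<forall>i<?n. R (k + i) = enc s i" for w x R xs s
    using that
  proof (induction xs arbitrary: R s)
    case (Cons a xs)
    let ?R = "sem w (?f a) R"
    have "held \<rho>' (x, s) R"
      using Cons.prems by (auto simp: held_def \<rho>'_def arity_prod_def enc_prod_def not_less dest!: le_Suc_ex)
    note d = d[OF this, of w a]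
    have 1: "agree k R ?R" using d by (auto simp: agree_def e)
    have 2: "\<forall>i<?n. ?R (k + i) = enc (G a w x s) i"
      using d by (auto simp: e add.assoc add.commute add.left_commute)
    show ?case
      using Cons.IH[OF held_agree[OF Cons.prems(1) k 1] 2] agree_trans[OF 1] by simp
  qed simp
  have "computes (Seq (Seq c (For ?f)) (move k (k + i))) \<rho> k (\<lambda>w x. enc (fold (\<lambda>a. G a w x) w (S w x)) i)"
    unfolding computes_def
  proof (intro allI impI)
    fix w x R assume h: "held \<rho> (x :: 'x) R"
    have "agree k (sem w c R) (sem w (For ?f) (sem w c R)) \<and>
       (\<forall>i<?n. sem w (For ?f) (sem w c R) (k + i) = enc (fold (\<lambda>a. G a w x) w (S w x)) i)"
      using loop[of x "sem w c R" "S w x" w w] held_agree[OF h k c(1)[OF h]] c(2)[OF h] by simp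
    then show "agree k R (sem w (Seq (Seq c (For ?f)) (move k (k + i))) R) \<and>
        sem w (Seq (Seq c (For ?f)) (move k (k + i))) R k = enc (fold (\<lambda>a. G a w x) w (S w x)) i"
      using i agree_trans[OF c(1)[OF h, of w]] by (simp add: agree_upd)
  qed
  then show "\<exists>c. computes c \<rho> k (\<lambda>w x. enc (fold (\<lambda>a. G a w x) w (S w x)) i)" by blast
qed

theorem computable_class_P:
  fixes F :: "'a::finite list \<Rightarrow> bool"
  assumes "computable (\<lambda>w (x::unit). F w)"
  shows "{w. F w} \<in> class_P"
proof -
  have "below TYPE(unit) \<rho> 0" for \<rho> by (simp add: below_def arity_unit_def)
  then obtain c where c: "computes c id 0 (\<lambda>w (x::unit). of_bool (F w))"
    using computable_boolD[OF assms] by metis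
  have "held id () (\<lambda>_. 0)" by (simp add: held_def arity_unit_def)
  then have "sem w c (\<lambda>_. 0) 0 = of_bool (F w)" for w
    using c by (auto simp: computes_def)
  then have "{w. F w} = {w. sem w c (\<lambda>_. 0) 0 > 0}" by simp
  then show ?thesis using com_class_P[of c] by simp
qed

text \<open>
  Multiplication is only available for a nonnegative factor bounded by the length of the input;
  unrestricted products would allow repeated squaring.
\<close>

definition clamp :: "'a list \<Rightarrow> int \<Rightarrow> int" where
  "clamp w y = int (min (nat y) (length w))"

lemma clamp_eq: "0 \<le> y \<Longrightarrow> y \<le> int (length w) \<Longrightarrow> clamp w y = y"
  by (simp add: clamp_def)

text \<open>A loop over the letters of \<open>w\<close> that ignores them, carries a counter and
  idles once the bound is reached; this is the reason for clamping the bound.\<close>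

lemma computable_loop:
  fixes S :: "'a list \<Rightarrow> 'x::ints \<Rightarrow> 's::ints"
  assumes "computable A" "computable S" "computable (\<lambda>w p. G w (fst p) (fst (snd p)) (snd (snd p)))"
  shows "computable (\<lambda>w x. fold (\<lambda>i. G w x (int i)) [0..<nat (clamp w (A w x))] (S w x))"
proof -
  let ?g = "\<lambda>A w x (i, s). if i < A w x then (i + 1, G w x i s) else (i, s)"
  \<comment> \<open>The start \<open>i\<close> is arbitrary for the induction; \<open>max i\<close>
    covers a bound that has already been passed.\<close>
  have 1: "fold (\<lambda>_. ?g A w x) ys (int i, s) =
    (let j = max i (min (i + length ys) (nat (A w x))) in (int j, fold (\<lambda>i. G w x (int i)) [i..<j] s))"
    for w x ys i s
  proof (induction ys arbitrary: i s)
    case (Cons y ys)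
    show ?case
    proof (cases "int i < A w x")
      case True
      then have m: "max i (min (i + length (y # ys)) (nat (A w x))) =
          max (Suc i) (min (Suc i + length ys) (nat (A w x)))" by auto
      show ?thesis
        using Cons.IH[of "Suc i" "G w x (int i) s"] True
        unfolding m by (simp add: Let_def upt_conv_Cons add.commute)
    next
      case False
      then show ?thesis using Cons.IH[of i s] by (simp add: Let_def)
    qed
  qed simp
  have 2: "fold (\<lambda>i. G w x (int i)) [0..<nat (clamp w (A w x))] (S w x) =
    snd (fold (\<lambda>_. ?g A w x) w (0, S w x))" for w x
    using 1[of w x w 0 "S w x"] by (simp add: Let_def clamp_def min.commute)
  have A: "computable (\<lambda>w p. A w (fst p))" by (intro computable_comp[OF computable_fst[OF computable_id] assms(1)])
  show ?thesis
    unfolding 2 case_prod_beta by (intro computable_intros computable_fold assms A)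
qed

definition cmult :: "'a list \<Rightarrow> int \<Rightarrow> int \<Rightarrow> int" where
  "cmult w y z = clamp w y * z"

lemma computable_cmult [computable_intros]:
  assumes "computable F" "computable G"
  shows "computable (\<lambda>w x. cmult w (F w x) (G w x))"
proof -
  have "computable (\<lambda>w p. snd (snd p) + G w (fst p))"
    by (intro computable_intros computable_comp[OF computable_fst[OF computable_id] assms(2)])
  then have "computable (\<lambda>w x. fold (\<lambda>i s. s + G w x) [0..<nat (clamp w (F w x))] 0)"
    by (intro computable_loop assms computable_const)
  moreover have "fold (\<lambda>i s. s + y) xs a = a + int (length xs) * y" for xs :: "nat list" and a y :: int
    by (induction xs arbitrary: a) (auto simp: algebra_simps)
  ultimately show ?thesis by (simp add: cmult_def clamp_def)
qed

text \<open>Horner's rule: every multiplication has the clamped argument as a factor.\<close>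

lemma computable_poly_clamp [computable_intros]:
  assumes "computable F"
  shows "computable (\<lambda>w x. poly q (clamp w (F w x)))"
proof (induction q)
  case 0
  then show ?case by (simp add: computable_const)
next
  case (pCons a q)
  have "computable (\<lambda>w x. a + cmult w (F w x) (poly q (clamp w (F w x))))"
    by (intro computable_intros assms pCons)
  then show ?case by (simp add: cmult_def)
qed


section \<open>Scanning the fields of an encoding\<close>

text \<open>
  A field is read letter by letter into a state of an automaton recognising the words
  \<open>binary_int v\<close> (0: empty, 1: after the sign, 2: the word \<open>[Zero]\<close>, 3: after a leading \<open>One\<close>,
  4: rejected), the sign, the absolute value, the length, and the absolute value multiplied by \<open>z\<close>.
  Building up the last component by doublings is how the language multiplies by long numbers.
\<close>

type_synonym field_state = "int \<times> bool \<times> int \<times> int \<times> int"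

fun field_step :: "int \<Rightarrow> letter \<Rightarrow> field_state \<Rightarrow> field_state" where
  "field_step z Zero (st, neg, m, l, p) =
     (if st = 0 then 2 else if st = 3 then 3 else 4, neg, 2 * m, l + 1, 2 * p)"
| "field_step z One (st, neg, m, l, p) =
     (if st = 0 \<or> st = 1 \<or> st = 3 then 3 else 4, neg, 2 * m + 1, l + 1, 2 * p + z)"
| "field_step z Minus (st, neg, m, l, p) = (if st = 0 then 1 else 4, True, m, l + 1, p)"
| "field_step z Sep (st, neg, m, l, p) = (4, neg, m, l + 1, p)"

definition field_start :: field_state where
  "field_start = (0, False, 0, 0, 0)"

definition field_end :: "field_state \<Rightarrow> bool \<times> int \<times> int \<times> int" where
  "field_end = (\<lambda>(st, neg, m, l, p).
     (st = 2 \<or> st = 3, if neg then - m else m, l, if neg then - p else p))"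

definition read_field :: "letter list \<Rightarrow> field_state" where
  "read_field f = fold (field_step 0) f field_start"

definition valid_field :: "letter list \<Rightarrow> bool" where
  "valid_field f = fst (field_end (read_field f))"

definition field_value :: "letter list \<Rightarrow> int" where
  "field_value f = fst (snd (field_end (read_field f)))"

text \<open>The fifth component stays \<open>z\<close> times the third: both are doubled together,
  and \<open>z\<close> is added exactly when 1 is. The other components do not depend on
  \<open>z\<close>.\<close>

lemma fold_field_step:
  "fold (field_step z) f (st, neg, m, l, z * m) =
     (case fold (field_step 0) f (st, neg, m, l, 0) of
        (st', neg', m', _) \<Rightarrow> (st', neg', m', l + int (length f), z * m'))"
proof (induction f arbitrary: st neg m l)
  case (Cons a f)
  have *: "2 * (z * m) = z * (2 * m)" "z * (2 * m) + z = z * (2 * m + 1)"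
    by (simp_all add: algebra_simps)
  show ?case
    by (cases a) (simp_all only: fold_Cons o_apply field_step.simps * Cons.IH mult_zero_right add_0_right
        length_Cons of_nat_Suc add.assoc add.commute[of 1])
qed simp

lemma field_end_read:
  "field_end (fold (field_step z) f field_start) =
     (valid_field f, field_value f, int (length f), field_value f * z)"
  using fold_field_step[of z f 0 False 0 0]
  by (auto simp: field_start_def valid_field_def field_value_def read_field_def field_end_def
      split: prod.splits)

lemma Sep_notin_binary: "Sep \<notin> set (binary n)"
proof (induction n rule: less_induct)
  case (less n)
  then show ?case by (subst binary.simps) auto
qed

lemma Sep_notin_binary_int: "Sep \<notin> set (binary_int a)"
  by (simp add: binary_int_def Sep_notin_binary)

lemma binary_0: "binary 0 = [Zero]"
  by (subst binary.simps) simp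

lemma binary_1: "binary (Suc 0) = [One]"
  by (subst binary.simps) simp

lemma binary_double: "1 \<le> n \<Longrightarrow> binary (2 * n) = binary n @ [Zero]"
  "1 \<le> n \<Longrightarrow> binary (Suc (2 * n)) = binary n @ [One]"
  by (subst binary.simps; simp)+

lemma fold_field_step_binary:
  assumes "1 \<le> n" "st = 0 \<or> st = 1"
  shows "\<exists>l'. fold (field_step 0) (binary n) (st, neg, 0, l, 0) = (3, neg, int n, l', 0)"
  using assms(1)
proof (induction n rule: less_induct)
  case (less n)
  show ?case
  proof (cases "n = 1")
    case True
    then show ?thesis using assms(2) by (auto simp: binary_1)
  next
    case False
    then have n: "1 \<le> n div 2" "n div 2 < n" using less.prems by auto
    obtain l' where l': "fold (field_step 0) (binary (n div 2)) (st, neg, 0, l, 0) = (3, neg, int (n div 2), l', 0)"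
      using less.IH[OF n(2,1)] by blast
    show ?thesis
    proof (cases "even n")
      case True
      then have "binary n = binary (n div 2) @ [Zero]" "int n = 2 * int (n div 2)"
        using binary_double(1)[OF n(1)] by auto
      then show ?thesis using l' by simp
    next
      case False
      then have "Suc (2 * (n div 2)) = n" by presburger
      then have "binary n = binary (n div 2) @ [One]" "int n = 2 * int (n div 2) + 1"
        using binary_double(2)[OF n(1)] by (metis, linarith)
      then show ?thesis using l' by simp
    qed
  qed
qed

lemma read_binary_int:
  "valid_field (binary_int a)" "field_value (binary_int a) = a"
proof -
  have "\<exists>st l. read_field (binary_int a) = (st, a < 0, \<bar>a\<bar>, l, 0) \<and> (st = 2 \<or> st = 3)"
  proof (cases "a = 0")
    case True
    then show ?thesis by (simp add: read_field_def binary_int_def binary_0 field_start_def)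
  next
    case False
    then have n: "1 \<le> nat \<bar>a\<bar>" by simp
    show ?thesis
      using fold_field_step_binary[OF n, of 0 False 0] fold_field_step_binary[OF n, of 1 True 1]
      by (auto simp: read_field_def binary_int_def field_start_def)
  qed
  then show "valid_field (binary_int a)" "field_value (binary_int a) = a"
    by (auto simp: valid_field_def field_value_def field_end_def)
qed

lemma valid_fieldD:
  assumes "valid_field f"
  shows "f = binary_int (field_value f)"
proof -
  obtain st neg m l p where r: "read_field f = (st, neg, m, l, p)" using prod_cases5 by blast
  \<comment> \<open>Each live state determines the word read so far, in state 3 with the help of the
    sign and the value. A sign must be followed by \<open>One\<close>, which excludes a negative
    zero.\<close>
  then have inv: "(st = 0 \<longrightarrow> f = [] \<and> \<not> neg \<and> m = 0) \<and> (st = 1 \<longrightarrow> f = [Minus] \<and> neg \<and> m = 0) \<and>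
      (st = 2 \<longrightarrow> f = [Zero] \<and> \<not> neg \<and> m = 0) \<and>
      (st = 3 \<longrightarrow> 1 \<le> m \<and> f = (if neg then [Minus] else []) @ binary (nat m))"
  proof (induction f arbitrary: st neg m l p rule: rev_induct)
    case Nil
    then show ?case by (auto simp: read_field_def field_start_def)
  next
    case (snoc a f)
    obtain st' neg' m' l' p' where r: "read_field f = (st', neg', m', l', p')" using prod_cases5 by blast
    have "read_field (f @ [a]) = field_step 0 a (st', neg', m', l', p')"
      using r by (simp add: read_field_def)
    then have step: "(st, neg, m, l, p) = field_step 0 a (st', neg', m', l', p')"
      using snoc.prems by simp
    note IH = snoc.IH[OF r]
    have nat: "1 \<le> m' \<Longrightarrow> nat (2 * m') = 2 * nat m' \<and> nat (2 * m' + 1) = Suc (2 * nat m')" by linarith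
    consider "st' = 0" | "st' = 1" | "st' = 2" | "st' = 3" | "st' \<notin> {0, 1, 2, 3}" by blast
    then show ?case
    proof cases
      case 4
      then have m: "1 \<le> m'" "f = (if neg' then [Minus] else []) @ binary (nat m')"
        using IH by simp_all
      have "1 \<le> nat m'" using m(1) by simp
      then have "binary (nat (2 * m')) = binary (nat m') @ [Zero]"
          "binary (nat (2 * m' + 1)) = binary (nat m') @ [One]"
        using nat[OF m(1)] binary_double[of "nat m'"] by simp_all
      then show ?thesis using step 4 m by (cases a) simp_all
    qed (use IH step in \<open>cases a; simp add: binary_1\<close>)+
  qed
  have st: "st = 2 \<or> st = 3" and v: "field_value f = (if neg then - m else m)"
    using assms r by (simp_all add: valid_field_def field_value_def field_end_def)
  show ?thesis
  proof (cases "st = 2")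
    case True
    then have "f = [Zero]" "field_value f = 0" using inv v by simp_all
    then show ?thesis by (simp only: binary_int_def) (simp add: binary_0)
  next
    case False
    then have f: "1 \<le> m" "f = (if neg then [Minus] else []) @ binary (nat m)" using inv st by simp_all
    then have "binary_int (field_value f) = (if neg then [Minus] else []) @ binary (nat m)"
      unfolding v binary_int_def by simp
    then show ?thesis using f(2) by (rule trans[OF _ sym, rotated])
  qed
qed

text \<open>The multiplier \<open>Z s\<close> stays fixed while a field is read, since
  \<open>s\<close> changes only at separators; this lets a running product be multiplied by the next
  field.\<close>

definition scan_step ::
  "(bool \<times> int \<times> int \<times> int \<Rightarrow> 's \<Rightarrow> 's) \<Rightarrow> ('s \<Rightarrow> int) \<Rightarrow> letter \<Rightarrow> field_state \<times> 's \<Rightarrow> field_state \<times> 's" where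
  "scan_step H Z a = (\<lambda>(fs, s).
     if a = Sep then (field_start, H (field_end fs) s) else (field_step (Z s) a fs, s))"

definition scan ::
  "(bool \<times> int \<times> int \<times> int \<Rightarrow> 's \<Rightarrow> 's) \<Rightarrow> ('s \<Rightarrow> int) \<Rightarrow> letter list \<Rightarrow> 's \<Rightarrow> 's" where
  "scan H Z w s = (case fold (scan_step H Z) w (field_start, s) of (fs, s') \<Rightarrow> H (field_end fs) s')"

lemma fold_scan_step_field:
  "Sep \<notin> set f \<Longrightarrow> fold (scan_step H Z) f (fs, s) = (fold (field_step (Z s)) f fs, s)"
  by (induction f arbitrary: fs) (auto simp: scan_step_def)

lemma scan_fields:
  assumes "\<forall>f \<in> set (f0 # fs). Sep \<notin> set f"
  shows "scan H Z (f0 @ concat (map ((#) Sep) fs)) s =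
    fold (\<lambda>f s. H (valid_field f, field_value f, int (length f), field_value f * Z s) s) (f0 # fs) s"
  using assms
proof (induction fs arbitrary: f0 s)
  case Nil
  then show ?case by (simp add: scan_def fold_scan_step_field field_end_read)
next
  case (Cons f fs)
  have "scan H Z (f0 @ concat (map ((#) Sep) (f # fs))) s =
      scan H Z (f @ concat (map ((#) Sep) fs))
        (H (valid_field f0, field_value f0, int (length f0), field_value f0 * Z s) s)"
    using Cons.prems
    by (simp add: scan_def fold_scan_step_field scan_step_def[of H Z Sep] field_end_read)
  then show ?case using Cons by simp
qed

text \<open>Lets the procedure be analysed on arbitrary words and not only on encodings.\<close>

lemma ex_fields: "\<exists>f0 fs. w = f0 @ concat (map ((#) Sep) fs) \<and> (\<forall>f \<in> set (f0 # fs). Sep \<notin> set f)"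
proof (induction w)
  case Nil
  show ?case by (rule exI[of _ "[]"], rule exI[of _ "[]"]) simp
next
  case (Cons a w)
  then obtain f0 fs where w: "w = f0 @ concat (map ((#) Sep) fs)" "\<forall>f \<in> set (f0 # fs). Sep \<notin> set f"
    by blast
  show ?case
  proof (cases "a = Sep")
    case True
    then show ?thesis using w by (intro exI[of _ "[]"] exI[of _ "f0 # fs"]) auto
  next
    case False
    then show ?thesis using w by (intro exI[of _ "a # f0"] exI[of _ fs]) auto
  qed
qed

definition pair_fields :: "int \<times> int \<Rightarrow> letter list list" where
  "pair_fields = (\<lambda>(a, b). [binary_int a, binary_int b])"

lemma encode_fields: "encode n ps = binary n @ concat (map ((#) Sep) (concat (map pair_fields ps)))"
proof -
  have "concat (map (\<lambda>(a, b). Sep # binary_int a @ Sep # binary_int b) ps) =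
      concat (map ((#) Sep) (concat (map pair_fields ps)))"
    by (induction ps) (auto simp: pair_fields_def)
  then show ?thesis by (simp add: encode_def)
qed

lemma binary_eq_binary_int: "binary n = binary_int (int n)"
  by (simp add: binary_int_def)

lemma scan_encode:
  "scan H Z (encode n ps) s =
    fold (\<lambda>(a, b) s.
        let s' = H (True, a, int (length (binary_int a)), a * Z s) s
        in H (True, b, int (length (binary_int b)), b * Z s') s') ps
      (H (True, int n, int (length (binary n)), int n * Z s) s)"
proof -
  let ?h = "\<lambda>f s. H (valid_field f, field_value f, int (length f), field_value f * Z s) s"
  have "\<forall>f \<in> set (binary n # concat (map pair_fields ps)). Sep \<notin> set f"
    by (auto simp: pair_fields_def Sep_notin_binary Sep_notin_binary_int)
  moreover have "fold ?h (concat (map pair_fields ps)) s =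
      fold (\<lambda>(a, b) s.
        let s' = H (True, a, int (length (binary_int a)), a * Z s) s
        in H (True, b, int (length (binary_int b)), b * Z s') s') ps s" for s
    by (induction ps arbitrary: s) (auto simp: pair_fields_def read_binary_int Let_def)
  moreover have "?h (binary n) s = H (True, int n, int (length (binary n)), int n * Z s) s"
    unfolding binary_eq_binary_int by (simp add: read_binary_int)
  ultimately show ?thesis by (simp add: encode_fields scan_fields)
qed

lemma computable_scan:
  fixes S :: "letter list \<Rightarrow> 'x::ints \<Rightarrow> 's::ints"
  assumes "computable S" and Z: "computable (\<lambda>w p. Z w (fst p) (snd p))"
    and H: "computable (\<lambda>w p. H w (fst p) (fst (snd p)) (snd (snd p)))"
  shows "computable (\<lambda>w x. scan (H w x) (Z w x) w (S w x))"
proof -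
  have H': "computable (\<lambda>w x. H w (A w x) (B w x) (C w x))"
    if "computable A" "computable B" "computable C" for A B and C :: "letter list \<Rightarrow> 'y::ints \<Rightarrow> 's"
    using computable_comp[OF computable_pair[OF that(1) computable_pair[OF that(2,3)]] H] by simp
  have Z': "computable (\<lambda>w x. Z w (A w x) (C w x))" if "computable A" "computable C" for A and C :: "letter list \<Rightarrow> 'y::ints \<Rightarrow> 's"
    using computable_comp[OF computable_pair[OF that] Z] by simp
  have E: "computable (\<lambda>w x. field_end (A w x))" if "computable A" for A :: "letter list \<Rightarrow> 'y::ints \<Rightarrow> field_state"
    unfolding field_end_def case_prod_beta by (intro computable_intros that)
  \<comment> \<open>Pattern matching is rewritten into projections, which
    \<open>computable_intros\<close> can handle. \<open>Sep\<close> has no equation here because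
    \<open>scan_step\<close> treats it as the end of a field.\<close>
  have eq: "field_step z Zero fs = (if fst fs = 0 then 2 else if fst fs = 3 then 3 else 4,
         fst (snd fs), 2 * fst (snd (snd fs)), fst (snd (snd (snd fs))) + 1, 2 * snd (snd (snd (snd fs))))"
      "field_step z One fs = (if fst fs = 0 \<or> fst fs = 1 \<or> fst fs = 3 then 3 else 4, fst (snd fs),
         2 * fst (snd (snd fs)) + 1, fst (snd (snd (snd fs))) + 1, 2 * snd (snd (snd (snd fs))) + z)"
      "field_step z Minus fs = (if fst fs = 0 then 1 else 4, True, fst (snd (snd fs)),
         fst (snd (snd (snd fs))) + 1, snd (snd (snd (snd fs))))"
    for z fs by (cases fs; simp)+
  have step: "computable (\<lambda>w p. scan_step (H w (fst p)) (Z w (fst p)) a (snd p))" for a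
    unfolding scan_step_def case_prod_beta
    by (cases a) (simp_all add: eq, (intro computable_intros H' Z' E)+)
  have eq: "scan (H w x) (Z w x) w (S w x) =
      H w x (field_end (fst (fold (scan_step (H w x) (Z w x)) w (field_start, S w x))))
        (snd (fold (scan_step (H w x) (Z w x)) w (field_start, S w x)))" for w x
    by (simp add: scan_def case_prod_beta)
  show ?thesis
    unfolding eq by (intro computable_intros H' E computable_fold step assms(1))
qed


section \<open>Weak causality as a sum of maxima\<close>

lemma finite_index_pairs: "finite (index_pairs n)"
  by (rule finite_subset[of _ "{..<n} \<times> {..<n}"]) (auto simp: index_pairs_def)

text \<open>Every vertex \<open>i\<close> has exactly one incoming arc \<open>(f i, i)\<close>, so
  the arcs are indexed by their receivers, and the senders can be chosen independently of each
  other.\<close>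

lemma sum_kefalopoda:
  assumes f: "\<And>i. i < n \<Longrightarrow> f i < n \<and> f i \<noteq> i"
  shows "(\<Sum>e\<in>index_pairs n. \<phi> e * adjacency_vector (kefalopoda n f) e * x e) =
    (\<Sum>i<n. \<phi> (f i, i) * x (f i, i))"
proof -
  let ?P = "(\<lambda>i. (f i, i)) ` {..<n}"
  have "parcs (kefalopoda n f) = ?P" by (auto simp: kefalopoda_def)
  then have adj: "adjacency_vector (kefalopoda n f) e = (if e \<in> ?P then 1 else 0)" for e
    by (simp only: adjacency_vector_def)
  have "?P \<subseteq> index_pairs n" using f by (auto simp: index_pairs_def)
  then have "(\<Sum>e\<in>index_pairs n. \<phi> e * adjacency_vector (kefalopoda n f) e * x e) =
      (\<Sum>e\<in>?P. \<phi> e * x e)"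
    by (intro sum.mono_neutral_cong_right finite_index_pairs) (auto simp: adj)
  also have "\<dots> = (\<Sum>i<n. \<phi> (f i, i) * x (f i, i))"
    by (subst sum.reindex) (auto simp: inj_on_def)
  finally show ?thesis .
qed

text \<open>\<open>M r\<close> is the maximum over the senders, specified by being an upper bound
  that is attained; in this form it can be instantiated by the rescaled output of the
  procedure.\<close>

lemma weakly_causal_iff:
  assumes p: "(p0, p1) \<in> probability_vectors n"
    and upper: "\<And>s r. s < n \<Longrightarrow> r < n \<Longrightarrow> s \<noteq> r \<Longrightarrow> \<bar>p0 (s, r) - p1 (s, r)\<bar> \<le> M r"
    and attained: "\<And>r. r < n \<Longrightarrow> \<exists>s<n. s \<noteq> r \<and> \<bar>p0 (s, r) - p1 (s, r)\<bar> = M r"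
  shows "(p0, p1) \<in> weakly_causal n \<longleftrightarrow> (\<Sum>r<n. M r) \<le> real n - 1"
proof
  assume wc: "(p0, p1) \<in> weakly_causal n"
  obtain g where g: "\<And>r. r < n \<Longrightarrow> g r < n \<and> g r \<noteq> r \<and> \<bar>p0 (g r, r) - p1 (g r, r)\<bar> = M r"
    using attained by metis
  define f where "f = restrict g {..<n}"
  \<comment> \<open>These signs turn each difference into its absolute value;
    \<open>restrict\<close> supplies the extensionality required of a sign vector.\<close>
  define \<phi> where "\<phi> = restrict (\<lambda>e. if p0 e \<ge> p1 e then 1 else - 1 :: real) (index_pairs n)"
  have f: "f i < n \<and> f i \<noteq> i" if "i < n" for i using g that by (simp add: f_def)
  have "f \<in> {..<n} \<rightarrow>\<^sub>E {..<n}" "\<phi> \<in> index_pairs n \<rightarrow>\<^sub>E {-1, 1}"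
    using g by (auto simp: f_def \<phi>_def)
  then have "(\<Sum>e\<in>index_pairs n. \<phi> e * adjacency_vector (kefalopoda n f) e * (p0 e - p1 e)) \<le> real n - 1"
    using wc f by (auto simp: weakly_causal_def)
  moreover have "\<phi> (f i, i) * (p0 (f i, i) - p1 (f i, i)) = M i" if "i < n" for i
    using g[OF that] f[OF that] that by (auto simp: \<phi>_def index_pairs_def f_def)
  ultimately show "(\<Sum>r<n. M r) \<le> real n - 1"
    by (simp add: sum_kefalopoda[OF f])
next
  assume M: "(\<Sum>r<n. M r) \<le> real n - 1"
  have "(\<Sum>e\<in>index_pairs n. \<phi> e * adjacency_vector (kefalopoda n f) e * (p0 e - p1 e)) \<le> real n - 1"
    if f: "f \<in> {..<n} \<rightarrow>\<^sub>E {..<n}" "\<forall>i<n. f i \<noteq> i" and \<phi>: "\<phi> \<in> index_pairs n \<rightarrow>\<^sub>E {-1, 1}" for f \<phi>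
  proof -
    have f': "f i < n \<and> f i \<noteq> i" if "i < n" for i using f that by auto
    have "\<phi> (f i, i) * (p0 (f i, i) - p1 (f i, i)) \<le> M i" if "i < n" for i
    proof -
      have "\<phi> (f i, i) \<in> {-1, 1}" using \<phi> f'[OF that] that by (auto simp: index_pairs_def)
      then show ?thesis using upper[of "f i" i] f'[OF that] that by auto
    qed
    then have "(\<Sum>i<n. \<phi> (f i, i) * (p0 (f i, i) - p1 (f i, i))) \<le> (\<Sum>i<n. M i)"
      by (intro sum_mono) simp
    then show ?thesis using M by (simp add: sum_kefalopoda[OF f'])
  qed
  then show "(p0, p1) \<in> weakly_causal n" using p by (simp add: weakly_causal_def)
qed


section \<open>The enumeration of the index pairs\<close>

lemma set_index_list: "set (index_list n) = index_pairs n"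
  by (auto simp: index_list_def index_pairs_def)

lemma index_list_eq:
  "index_list n = concat (map (\<lambda>s. map (Pair s) (filter (\<lambda>r. s \<noteq> r) [0..<n])) [0..<n])"
proof -
  have "concat (map (\<lambda>r. if s \<noteq> r then [(s, r)] else []) xs) = map (Pair s) (filter (\<lambda>r. s \<noteq> r) xs)"
    for s and xs :: "nat list"
    by (induction xs) auto
  then show ?thesis by (simp add: index_list_def)
qed

lemma filter_neq_upt:
  assumes "s < n"
  shows "filter (\<lambda>r. s \<noteq> r) [0..<n] = [0..<s] @ [Suc s..<n]"
proof -
  have "[0..<n] = [0..<s] @ s # [Suc s..<n]"
    using assms upt_add_eq_append[of 0 s "n - s"] by (simp add: upt_conv_Cons)
  moreover have "filter (\<lambda>r. s \<noteq> r) [0..<s] = [0..<s]" "filter (\<lambda>r. s \<noteq> r) [Suc s..<n] = [Suc s..<n]"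
    by (auto simp: filter_id_conv)
  ultimately show ?thesis by simp
qed

lemma nth_concat_uniform:
  assumes "\<And>xs. xs \<in> set xss \<Longrightarrow> length xs = l" "i < length xss" "j < l"
  shows "concat xss ! (i * l + j) = xss ! i ! j"
  using assms
proof (induction xss arbitrary: i)
  case (Cons xs xss)
  then show ?case by (cases i) (auto simp: nth_append)
qed simp

lemma length_concat_uniform:
  assumes "\<And>xs. xs \<in> set xss \<Longrightarrow> length xs = l"
  shows "length (concat xss) = length xss * l"
  using assms by (induction xss) auto

lemma length_row: "s < n \<Longrightarrow> length (filter (\<lambda>r. s \<noteq> r) [0..<n]) = n - Suc 0"
  by (simp add: filter_neq_upt)

lemma length_index_list: "length (index_list n) = n * (n - 1)"
  unfolding index_list_eq by (subst length_concat_uniform[where l = "n - 1"]) (auto simp: length_row)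

text \<open>A row lacks its diagonal entry: it has \<open>n - 1\<close> elements, and the columns
  beyond the diagonal shift by one.\<close>

definition position :: "nat \<Rightarrow> nat \<Rightarrow> nat \<Rightarrow> nat" where
  "position n s r = s * (n - 1) + (if r < s then r else r - 1)"

lemma position:
  assumes "s < n" "r < n" "s \<noteq> r"
  shows "position n s r < n * (n - 1)" "index_list n ! position n s r = (s, r)"
proof -
  let ?j = "if r < s then r else r - 1"
  have j: "?j < n - 1" using assms by auto
  have "position n s r < Suc s * (n - 1)" using j by (simp add: position_def)
  also have "\<dots> \<le> n * (n - 1)" using assms(1) by (intro mult_le_mono1) simp
  finally show "position n s r < n * (n - 1)" .
  have "index_list n ! position n s r = map (Pair s) (filter (\<lambda>r. s \<noteq> r) [0..<n]) ! ?j"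
    unfolding index_list_eq position_def
    by (subst nth_concat_uniform[where l = "n - 1"]) (use assms(1) j in \<open>auto simp: length_row\<close>)
  also have "\<dots> = (s, r)"
    using assms j by (auto simp: filter_neq_upt nth_append)
  finally show "index_list n ! position n s r = (s, r)" .
qed

lemma distinct_index_list: "distinct (index_list n)"
proof (rule card_distinct)
  have "index_pairs n = (SIGMA s:{..<n}. {..<n} - {s})" by (auto simp: index_pairs_def)
  then have "card (index_pairs n) = n * (n - 1)" by simp
  then show "card (set (index_list n)) = length (index_list n)"
    by (simp add: set_index_list length_index_list)
qed


section \<open>The decision procedure\<close>

definition header :: "letter list \<Rightarrow> int" where
  "header w = snd (scan (\<lambda>(v, y, l, p) (first, n). (False, if first then y else n)) (\<lambda>_. 0) w (True, 0))"

text \<open>Phase 0 reads \<open>n\<close>, phase 1 expects a numerator, phase 2 a denominator;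
  ending in phase 1 means that no numerator is left alone. The two alternatives put the fraction
  into the unit interval for either sign of the denominator.\<close>

definition check_step :: "int \<Rightarrow> bool \<times> int \<times> int \<times> int \<Rightarrow> int \<times> int \<times> int \<times> bool \<Rightarrow> int \<times> int \<times> int \<times> bool" where
  "check_step B = (\<lambda>(v, y, l, p) (ph, a, c, ok).
     if ph = 0 then (1, 0, 0, v \<and> 0 \<le> y)
     else if ph = 1 then (2, y, c, ok \<and> v \<and> l \<le> B)
     else (1, a, c + 1, ok \<and> v \<and> l \<le> B \<and> y \<noteq> 0 \<and> (0 \<le> a \<and> a \<le> y \<or> y \<le> a \<and> a \<le> 0)))"

definition check :: "int \<Rightarrow> letter list \<Rightarrow> int \<times> int \<times> int \<times> bool" where
  "check B w = scan (check_step B) (\<lambda>_. 0) w (0, 0, 0, False)"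

text \<open>\<open>p\<close> is the current field times the running product \<open>z\<close>, which
  \<open>product\<close> passes to \<open>scan\<close> as multiplier. The leading field
  \<open>n\<close> is skipped by resetting the product to 1.\<close>

definition product_step :: "int \<Rightarrow> bool \<times> int \<times> int \<times> int \<Rightarrow> int \<times> int \<times> int \<Rightarrow> int \<times> int \<times> int" where
  "product_step k = (\<lambda>(v, y, l, p) (ph, j, z).
     if ph = 0 then (1, 0, 1)
     else if ph = 1 then (2, j, if j = k then p else z)
     else (1, j + 1, if j = k then z else p))"

text \<open>
  The product of all denominators, in which the denominator with number \<open>k\<close> is replaced by its
  numerator: the entry with number \<open>k\<close> scaled by the common denominator, which is
  \<open>product w (- 1)\<close>.
\<close>

definition product :: "letter list \<Rightarrow> int \<Rightarrow> int" where
  "product w k = snd (snd (scan (product_step k) (\<lambda>s. snd (snd s)) w (0, 0, 1)))"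

definition entry :: "letter list \<Rightarrow> int \<Rightarrow> int \<Rightarrow> int \<Rightarrow> int" where
  "entry w n s r = cmult w s (n - 1) + (if r < s then r else r - 1)"

definition influence :: "letter list \<Rightarrow> int \<Rightarrow> int \<Rightarrow> int" where
  "influence w d k = \<bar>product w k - product w (k + d)\<bar>"

text \<open>Starting the maximum at 0 is harmless because influences are absolute values.\<close>

definition best :: "letter list \<Rightarrow> int \<Rightarrow> int \<Rightarrow> int \<Rightarrow> int" where
  "best w n d r = fold (\<lambda>s m. if int s = r then m else max m (influence w d (entry w n (int s) r)))
     [0..<nat (clamp w n)] 0"

definition sum_best :: "letter list \<Rightarrow> int \<Rightarrow> int \<Rightarrow> int" where
  "sum_best w n d = fold (\<lambda>r t. t + best w n d (int r)) [0..<nat (clamp w n)] 0"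

text \<open>\<open>cmult w n 1 = n\<close> forces \<open>n\<close> to be at most the length of
  \<open>w\<close>, which makes the other clamped products exact. On encodings, the correct number
  of pairs likewise makes \<open>clamp w (2 * d)\<close> exact.\<close>

definition decide_at :: "int poly \<Rightarrow> letter list \<Rightarrow> int \<Rightarrow> int \<Rightarrow> bool" where
  "decide_at q w n d \<longleftrightarrow>
     2 \<le> n \<and> cmult w n 1 = n \<and> fst (check (poly q (clamp w (2 * d))) w) = 1 \<and>
     fst (snd (snd (check (poly q (clamp w (2 * d))) w))) = 2 * d \<and>
     snd (snd (snd (check (poly q (clamp w (2 * d))) w))) \<and>
     sum_best w n d \<le> cmult w (n - 1) \<bar>product w (- 1)\<bar>"

definition decide :: "int poly \<Rightarrow> letter list \<Rightarrow> bool" where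
  "decide q w \<longleftrightarrow> decide_at q w (header w) (cmult w (header w) (header w - 1))"

section \<open>Computability of the decision procedure\<close>

lemma computable_fst_arg: "computable F \<Longrightarrow> computable (\<lambda>w p. F w (fst p))"
  by (rule computable_comp[OF computable_fst[OF computable_id]])

lemma computable_max [computable_intros]: "computable F \<Longrightarrow> computable G \<Longrightarrow> computable (\<lambda>w x. max (F w x) (G w x :: int))"
  unfolding max_def by (intro computable_intros)

lemma computable_header [computable_intros]: "computable (\<lambda>w x. header w)"
  unfolding header_def by (intro computable_snd computable_scan computable_const; simp only: case_prod_beta; intro computable_intros)

lemma computable_check [computable_intros]:
  assumes "computable F"
  shows "computable (\<lambda>w x. check (F w x) w)"
  unfolding check_def
  by (intro computable_scan computable_const; simp only: check_step_def case_prod_beta; intro computable_intros computable_fst_arg assms)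

lemma computable_product [computable_intros]:
  assumes "computable F"
  shows "computable (\<lambda>w x. product w (F w x))"
  unfolding product_def
  by (intro computable_snd computable_scan computable_const; (simp only: product_step_def case_prod_beta)?; intro computable_intros computable_fst_arg assms)

lemma computable_influence [computable_intros]:
  "computable D \<Longrightarrow> computable K \<Longrightarrow> computable (\<lambda>w x. influence w (D w x) (K w x))"
  unfolding influence_def by (intro computable_intros)

lemma computable_entry [computable_intros]:
  "computable N \<Longrightarrow> computable S \<Longrightarrow> computable R \<Longrightarrow> computable (\<lambda>w x. entry w (N w x) (S w x) (R w x))"
  unfolding entry_def by (intro computable_intros)

lemma computable_best [computable_intros]:
  assumes "computable N" "computable D" "computable R"
  shows "computable (\<lambda>w x. best w (N w x) (D w x) (R w x))"
  unfolding best_def by (intro computable_loop computable_intros assms computable_fst_arg)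

lemma computable_sum_best [computable_intros]:
  assumes "computable N" "computable D"
  shows "computable (\<lambda>w x. sum_best w (N w x) (D w x))"
  unfolding sum_best_def by (intro computable_loop computable_intros assms computable_fst_arg)

lemma computable_decide: "computable (\<lambda>w x. decide q w)"
  unfolding decide_def decide_at_def by (intro computable_intros)


section \<open>Correctness of the decision procedure\<close>

lemma header_encode: "header (encode n ps) = int n"
proof -
  have "fold (\<lambda>(a, b) s. let s' = (case s of (first, m) \<Rightarrow> (False, if first then a else m))
      in (case s' of (first, m) \<Rightarrow> (False, if first then b else m))) ps (False, y) = (False, y :: int)" for y
    by (induction ps) auto
  then show ?thesis by (simp add: header_def scan_encode)
qed

definition acceptable :: "int \<Rightarrow> int \<times> int \<Rightarrow> bool" where
  "acceptable B = (\<lambda>(a, b). int (length (binary_int a)) \<le> B \<and> int (length (binary_int b)) \<le> B \<and>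
     b \<noteq> 0 \<and> (0 \<le> a \<and> a \<le> b \<or> b \<le> a \<and> a \<le> 0))"

lemma check_encode:
  "\<exists>a. check B (encode n ps) = (1, a, int (length ps), \<forall>p\<in>set ps. acceptable B p)"
proof -
  let ?h = "\<lambda>(a, b) s. let s' = check_step B (True, a, int (length (binary_int a)), a * 0) s
        in check_step B (True, b, int (length (binary_int b)), b * 0) s'"
  have "\<exists>a'. fold ?h ps (1, a, c, ok) = (1, a', c + int (length ps), ok \<and> (\<forall>p\<in>set ps. acceptable B p))" for a c ok
  proof (induction ps arbitrary: a c ok)
    case (Cons p ps)
    obtain x y where p: "p = (x, y)" by fastforce
    have "?h p (1, a, c, ok) = (1, x, c + 1, ok \<and> acceptable B p)"
      by (auto simp: p check_step_def acceptable_def Let_def)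
    moreover obtain a' where
      "fold ?h ps (1, x, c + 1, ok \<and> acceptable B p) =
        (1, a', c + 1 + int (length ps), (ok \<and> acceptable B p) \<and> (\<forall>p\<in>set ps. acceptable B p))"
      using Cons.IH by blast
    ultimately show ?case by (simp add: conj_assoc)
  qed simp
  from this[of 0 0 True] obtain a where
    "fold ?h ps (1, 0, 0, True) = (1, a, int (length ps), \<forall>p\<in>set ps. acceptable B p)" by auto
  moreover have "check B (encode n ps) = fold ?h ps (check_step B (True, int n, int (length (binary n)), int n * 0) (0, 0, 0, False))"
    unfolding check_def by (rule scan_encode)
  ultimately show ?thesis by (simp add: check_step_def)
qed

text \<open>Fields are consumed in pairs by an induction in steps of two; a leftover field would end
  in phase 2. Each valid field is the canonical word of its value, so the word can be reassembled as
  an encoding.\<close>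

lemma check_true:
  assumes "check B w = (1, a, c, True)"
  shows "\<exists>n ps. w = encode n ps"
proof -
  obtain f0 fs where w: "w = f0 @ concat (map ((#) Sep) fs)" "\<forall>f \<in> set (f0 # fs). Sep \<notin> set f"
    using ex_fields by blast
  let ?h = "\<lambda>f. check_step B (valid_field f, field_value f, int (length f), field_value f * 0)"
  have fs: "ok \<and> (\<exists>ps. gs = concat (map pair_fields ps))"
    if "fold ?h gs (1, a, c, ok) = (1, a', c', True)" for gs a c ok a' c'
    using that
  proof (induction gs arbitrary: a c ok rule: induct_list012)
    case 1
    then show ?case by (auto intro: exI[of _ "[]"])
  next
    case (2 f)
    then show ?case by (auto simp: check_step_def)
  next
    case (3 f g gs)
    let ?ok = "(ok \<and> valid_field f \<and> int (length f) \<le> B) \<and> valid_field g \<and> int (length g) \<le> B \<and> field_value g \<noteq> 0 \<and>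
      (0 \<le> field_value f \<and> field_value f \<le> field_value g \<or> field_value g \<le> field_value f \<and> field_value f \<le> 0)"
    have "fold ?h gs (1, field_value f, c + 1, ?ok) = (1, a', c', True)"
      using "3.prems" by (simp add: check_step_def)
    from "3.IH"(1)[OF this] obtain ps where ok: "?ok" "gs = concat (map pair_fields ps)" by blast
    then have "f # g # gs = concat (map pair_fields ((field_value f, field_value g) # ps))"
      using valid_fieldD[of f] valid_fieldD[of g] by (simp add: pair_fields_def)
    then show ?case using ok(1) by blast
  qed
  have "fold ?h fs (1, 0, 0, valid_field f0 \<and> 0 \<le> field_value f0) = (1, a, c, True)"
    using assms unfolding check_def w(1) scan_fields[OF w(2)] by (simp add: check_step_def)
  from fs[OF this] obtain ps where f0: "valid_field f0" "0 \<le> field_value f0" and ps: "fs = concat (map pair_fields ps)"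
    by blast
  have "f0 = binary (nat (field_value f0))"
    using valid_fieldD[OF f0(1)] f0(2) by (simp add: binary_eq_binary_int)
  then have "w = encode (nat (field_value f0)) ps" unfolding encode_fields w(1) ps by simp
  then show ?thesis by blast
qed

lemma product_encode:
  "product (encode n ps) k = (\<Prod>j<length ps. if int j = k then fst (ps ! j) else snd (ps ! j))"
proof -
  let ?h = "\<lambda>(a, b) s. let s' = product_step k (True, a, int (length (binary_int a)), a * snd (snd s)) s
        in product_step k (True, b, int (length (binary_int b)), b * snd (snd s')) s'"
  have "fold ?h ps (1, i, z) = (1, i + int (length ps),
      z * (\<Prod>j<length ps. if i + int j = k then fst (ps ! j) else snd (ps ! j)))" for i z
  proof (induction ps arbitrary: i z)
    case (Cons p ps)
    obtain a b where p: "p = (a, b)" by fastforce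
    have "?h p (1, i, z) = (1, i + 1, z * (if i = k then a else b))"
      by (simp add: p product_step_def Let_def)
    moreover have "(\<Prod>j<length (p # ps). if i + int j = k then fst ((p # ps) ! j) else snd ((p # ps) ! j)) =
        (if i = k then a else b) * (\<Prod>j<length ps. if i + 1 + int j = k then fst (ps ! j) else snd (ps ! j))"
      unfolding length_Cons prod.lessThan_Suc_shift by (simp add: p add.assoc cong: if_cong)
    ultimately show ?case
      by (simp only: fold_Cons o_apply Cons.IH) (simp add: mult.assoc)
  qed simp
  then have "fold ?h ps (1, 0, 1) = (1, int (length ps), \<Prod>j<length ps. if int j = k then fst (ps ! j) else snd (ps ! j))"
    by simp
  moreover have "scan (product_step k) (\<lambda>s. snd (snd s)) (encode n ps) (0, 0, 1) =
      fold ?h ps (product_step k (True, int n, int (length (binary n)), int n * snd (snd (0::int, 0::int, 1::int))) (0, 0, 1))"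
    by (rule scan_encode)
  ultimately show ?thesis unfolding product_def by (simp add: product_step_def)
qed

definition fraction :: "int \<times> int \<Rightarrow> real" where
  "fraction = (\<lambda>(a, b). of_int a / of_int b)"

text \<open>Both products share all factors but number \<open>i\<close>; replacing the denominator
  there by the numerator amounts to multiplying by the fraction.\<close>

lemma product_encode_fraction:
  assumes "i < length ps" "snd (ps ! i) \<noteq> 0"
  shows "of_int (product (encode n ps) (int i)) =
    fraction (ps ! i) * of_int (product (encode n ps) (- 1))"
proof -
  let ?A = "{..<length ps}"
  have "product (encode n ps) (int i) = (\<Prod>j\<in>?A. if j = i then fst (ps ! j) else snd (ps ! j))"
    by (simp add: product_encode)
  also have "\<dots> = fst (ps ! i) * (\<Prod>j\<in>?A - {i}. snd (ps ! j))"
    using assms(1) by (simp add: prod.delta_remove)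
  finally have 1: "product (encode n ps) (int i) = fst (ps ! i) * (\<Prod>j\<in>?A - {i}. snd (ps ! j))" .
  have "product (encode n ps) (- 1) = (\<Prod>j\<in>?A. snd (ps ! j))"
    by (simp add: product_encode)
  also have "\<dots> = snd (ps ! i) * (\<Prod>j\<in>?A - {i}. snd (ps ! j))"
    using assms(1) by (intro prod.remove) auto
  finally show ?thesis using 1 assms(2) by (simp add: fraction_def case_prod_beta)
qed

lemma product_encode_nonzero:
  "\<forall>p\<in>set ps. snd p \<noteq> 0 \<Longrightarrow> product (encode n ps) (- 1) \<noteq> 0"
  by (simp add: product_encode prod_zero_iff)

lemma le_mult_pred: "2 \<le> n \<Longrightarrow> n \<le> n * (n - 1 :: nat)"
  using mult_le_mono2[of 1 "n - 1" n] by linarith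

text \<open>Each pair brings two separators. This bounds \<open>n\<close> and the dimension by the
  length of the word, which justifies the clamping.\<close>

lemma length_encode: "2 * length ps \<le> length (encode n ps)"
  by (induction ps) (auto simp: encode_def)

lemma fold_max:
  fixes y :: "nat \<Rightarrow> int" and r :: nat
  defines "m \<equiv> \<lambda>xs a. fold (\<lambda>s m. if s = r then m else max m (y s)) xs a"
  shows "a \<le> m xs a" "s \<in> set xs \<Longrightarrow> s \<noteq> r \<Longrightarrow> y s \<le> m xs a"
    "m xs a = a \<or> (\<exists>s\<in>set xs. s \<noteq> r \<and> m xs a = y s)"
proof -
  show 1: "a \<le> m xs a" for xs a
  proof (induction xs arbitrary: a)
    case (Cons x xs)
    have "m (x # xs) a = m xs (if x = r then a else max a (y x))" by (simp add: m_def)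
    then show ?case using Cons.IH[of "if x = r then a else max a (y x)"] by (auto split: if_splits)
  qed (simp add: m_def)
  show "y s \<le> m xs a" if "s \<in> set xs" "s \<noteq> r"
    using that(1)
  proof (induction xs arbitrary: a)
    case (Cons x xs)
    have "m (x # xs) a = m xs (if x = r then a else max a (y x))" by (simp add: m_def)
    then show ?case using Cons 1[of "max a (y x)" xs] that(2) by auto
  qed simp
  show "m xs a = a \<or> (\<exists>s\<in>set xs. s \<noteq> r \<and> m xs a = y s)"
  proof (induction xs arbitrary: a)
    case (Cons x xs)
    have "m (x # xs) a = m xs (if x = r then a else max a (y x))" by (simp add: m_def)
    then show ?case using Cons.IH[of "if x = r then a else max a (y x)"] by (auto simp: max_def split: if_splits)
  qed (simp add: m_def)
qed

lemma fold_add: "fold (\<lambda>r t. t + f r) xs a = a + (\<Sum>r\<leftarrow>xs. f r :: int)"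
  by (induction xs arbitrary: a) auto

text \<open>All influences are scaled by the same positive \<open>D\<close>, and maxima, sums and
  the comparison scale along. The absolute value in \<open>D\<close> accounts for negative
  denominators.\<close>

lemma weakly_causal_decided:
  assumes n: "2 \<le> n" and len: "length ps = 2 * (n * (n - 1))"
    and nz: "\<forall>p\<in>set ps. snd p \<noteq> 0"
    and p: "(p0, p1) \<in> probability_vectors n"
    and map: "map fraction ps = map p0 (index_list n) @ map p1 (index_list n)"
  shows "(p0, p1) \<in> weakly_causal n \<longleftrightarrow>
    sum_best (encode n ps) (int n) (int (n * (n - 1))) \<le> (int n - 1) * \<bar>product (encode n ps) (- 1)\<bar>"
proof -
  let ?w = "encode n ps" and ?d = "n * (n - 1)"
  define D where "D = \<bar>real_of_int (product ?w (- 1))\<bar>"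
  have D: "D > 0" using product_encode_nonzero[OF nz] by (simp add: D_def)
  have nw: "n \<le> length ?w"
    using le_mult_pred[OF n] length_encode[of ps n] len by linarith
  have clamp: "clamp ?w (int m) = int m" if "m \<le> n" for m
    using that nw by (intro clamp_eq) auto
  have entry: "entry ?w (int n) (int s) (int r) = int (position n s r)" if "s < n" "s \<noteq> r" for s r
    using that n by (auto simp: entry_def position_def cmult_def clamp of_nat_diff)
  have frac: "fraction (ps ! i) = (map p0 (index_list n) @ map p1 (index_list n)) ! i" if "i < length ps" for i
    using that map by (metis nth_map)
  have infl: "of_int (influence ?w (int ?d) (entry ?w (int n) (int s) (int r))) = D * \<bar>p0 (s, r) - p1 (s, r)\<bar>"
    if sr: "s < n" "r < n" "s \<noteq> r" for s r
  proof -
    let ?i = "position n s r"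
    have i: "?i < ?d" by (rule position(1)[OF sr])
    then have l: "?i < length ps" "?i + ?d < length ps" using len by auto
    have "of_int (product ?w (int ?i)) = p0 (s, r) * of_int (product ?w (- 1))"
      using product_encode_fraction[OF l(1), of n] nz l(1) frac[OF l(1)] i position(2)[OF sr]
      by (simp add: nth_append length_index_list)
    moreover have "of_int (product ?w (int (?i + ?d))) = p1 (s, r) * of_int (product ?w (- 1))"
      using product_encode_fraction[OF l(2), of n] nz l(2) frac[OF l(2)] i position(2)[OF sr]
      by (simp add: nth_append length_index_list)
    ultimately have "of_int (product ?w (int ?i) - product ?w (int (?i + ?d))) =
        (p0 (s, r) - p1 (s, r)) * of_int (product ?w (- 1))"
      by (simp only: of_int_diff left_diff_distrib)
    then have "\<bar>of_int (product ?w (int ?i) - product ?w (int (?i + ?d)))\<bar> = D * \<bar>p0 (s, r) - p1 (s, r)\<bar>"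
      by (simp only: abs_mult D_def mult.commute)
    then show ?thesis by (simp add: influence_def entry[OF sr(1,3)])
  qed
  define M where "M r = of_int (best ?w (int n) (int ?d) (int r)) / D" for r
  have best: "best ?w (int n) (int ?d) (int r) =
      fold (\<lambda>s m. if s = r then m else max m (influence ?w (int ?d) (entry ?w (int n) (int s) (int r)))) [0..<n] 0" for r
    by (simp add: best_def clamp cong: if_cong)
  have upper: "\<bar>p0 (s, r) - p1 (s, r)\<bar> \<le> M r" if sr: "s < n" "r < n" "s \<noteq> r" for s r
  proof -
    have "influence ?w (int ?d) (entry ?w (int n) (int s) (int r)) \<le> best ?w (int n) (int ?d) (int r)"
      unfolding best using sr by (intro fold_max(2)) auto
    then have "D * \<bar>p0 (s, r) - p1 (s, r)\<bar> \<le> of_int (best ?w (int n) (int ?d) (int r))"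
      unfolding infl[OF sr, symmetric] by simp
    then show ?thesis using D by (simp add: M_def field_simps)
  qed
  have attained: "\<exists>s<n. s \<noteq> r \<and> \<bar>p0 (s, r) - p1 (s, r)\<bar> = M r" if r: "r < n" for r
  proof -
    have "best ?w (int n) (int ?d) (int r) = 0 \<or>
        (\<exists>s\<in>set [0..<n]. s \<noteq> r \<and> best ?w (int n) (int ?d) (int r) =
           influence ?w (int ?d) (entry ?w (int n) (int s) (int r)))"
      unfolding best by (rule fold_max(3))
    then show ?thesis
    proof
      \<comment> \<open>Here the maximum may be just the starting value. Any
        \<open>s \<noteq> r\<close> is then a witness, as its difference is at most
        \<open>M r = 0\<close>; one exists because \<open>2 \<le> n\<close>.\<close>
      assume "best ?w (int n) (int ?d) (int r) = 0"
      then have "M r = 0" by (simp add: M_def)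
      moreover define s where "s = (if r = 0 then 1 else 0 :: nat)"
      moreover have "s < n" "s \<noteq> r" using n by (auto simp: s_def)
      ultimately show ?thesis using upper[of s r] r by (intro exI[of _ s]) auto
    next
      assume "\<exists>s\<in>set [0..<n]. s \<noteq> r \<and> best ?w (int n) (int ?d) (int r) =
           influence ?w (int ?d) (entry ?w (int n) (int s) (int r))"
      then obtain s where s: "s < n" "s \<noteq> r" "best ?w (int n) (int ?d) (int r) =
           influence ?w (int ?d) (entry ?w (int n) (int s) (int r))" by auto
      then have "M r = \<bar>p0 (s, r) - p1 (s, r)\<bar>" using infl[OF s(1) r s(2)] D by (simp add: M_def)
      then show ?thesis using s by auto
    qed
  qed
  have "of_int (sum_best ?w (int n) (int ?d)) = (\<Sum>r<n. of_int (best ?w (int n) (int ?d) (int r)) :: real)"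
    by (simp add: sum_best_def clamp fold_add interv_sum_list_conv_sum_set_nat atLeast0LessThan)
  also have "\<dots> = D * (\<Sum>r<n. M r)"
    using D by (simp add: M_def sum_distrib_left)
  finally have tot: "of_int (sum_best ?w (int n) (int ?d)) = D * (\<Sum>r<n. M r)" .
  have "sum_best ?w (int n) (int ?d) \<le> (int n - 1) * \<bar>product ?w (- 1)\<bar> \<longleftrightarrow>
      real_of_int (sum_best ?w (int n) (int ?d)) \<le> of_int ((int n - 1) * \<bar>product ?w (- 1)\<bar>)"
    by (simp only: of_int_le_iff)
  also have "\<dots> \<longleftrightarrow> D * (\<Sum>r<n. M r) \<le> D * (real n - 1)"
    using tot by (simp add: D_def mult.commute)
  also have "\<dots> \<longleftrightarrow> (\<Sum>r<n. M r) \<le> real n - 1" using D by simp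
  finally show ?thesis using weakly_causal_iff[OF p upper attained] by blast
qed

lemma fraction_unit:
  "b \<noteq> 0 \<Longrightarrow> 0 \<le> fraction (a, b) \<and> fraction (a, b) \<le> 1 \<longleftrightarrow> 0 \<le> a \<and> a \<le> b \<or> b \<le> a \<and> a \<le> 0"
  by (auto simp: fraction_def field_simps zero_le_divide_iff divide_le_eq_1 split: if_splits)

lemma decide_encode:
  "decide q (encode n ps) \<longleftrightarrow> 2 \<le> n \<and> length ps = 2 * (n * (n - 1)) \<and>
     (\<forall>p\<in>set ps. acceptable (poly q (int (2 * (n * (n - 1))))) p) \<and>
     sum_best (encode n ps) (int n) (int (n * (n - 1))) \<le> (int n - 1) * \<bar>product (encode n ps) (- 1)\<bar>"
proof -
  let ?w = "encode n ps" and ?d = "n * (n - 1)"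
  have c: "fst (check B ?w) = 1" "fst (snd (snd (check B ?w))) = int (length ps)"
      "snd (snd (snd (check B ?w))) \<longleftrightarrow> (\<forall>p\<in>set ps. acceptable B p)" for B
    using check_encode[of B n ps] by auto
  show ?thesis
  proof (cases "2 \<le> n \<and> n \<le> length ?w")
    case True
    then have cm: "cmult ?w (int n) y = int n * y" "cmult ?w (int n - 1) y = (int n - 1) * y" for y
      by (auto simp: cmult_def clamp_eq)
    have d: "int n * (int n - 1) = int ?d" using True by (simp add: of_nat_diff)
    have "int (length ps) = 2 * int ?d \<Longrightarrow> clamp ?w (2 * int ?d) = int (2 * ?d)"
      using length_encode[of ps n] by (subst clamp_eq) auto
    moreover have "int (length ps) = 2 * int ?d \<longleftrightarrow> length ps = 2 * ?d" by linarith
    ultimately show ?thesis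
      using True by (auto simp: decide_def decide_at_def header_encode cm c d simp del: of_nat_mult)
  next
    \<comment> \<open>Both sides fail: for \<open>n \<ge> 2\<close> beyond the length of the word,
      the required pairs would need more separators than there are letters.\<close>
    case False
    have "\<not> (2 \<le> n \<and> length ps = 2 * ?d)"
    proof
      assume *: "2 \<le> n \<and> length ps = 2 * ?d"
      then show False using le_mult_pred[of n] False length_encode[of ps n] by linarith
    qed
    moreover have "cmult ?w (int n) 1 = int n \<Longrightarrow> n \<le> length ?w"
      by (simp add: cmult_def clamp_def)
    ultimately show ?thesis using False by (auto simp: decide_def decide_at_def header_encode)
  qed
qed

lemma decide_iff: "w \<in> weakly_causal_correlations q \<longleftrightarrow> decide q w"
proof
  assume "w \<in> weakly_causal_correlations q"
  then obtain n p where n: "2 \<le> n" and p: "p \<in> probability_vectors n" "encodes q n w p" "p \<in> weakly_causal n"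
    unfolding weakly_causal_correlations_def by blast
  let ?B = "poly q (int (2 * (n * (n - 1))))"
  obtain p0 p1 where p01: "p = (p0, p1)" by fastforce
  obtain ps where w: "w = encode n ps"
    and ps: "\<forall>(a, b)\<in>set ps. b \<noteq> 0 \<and> int (length (binary_int a)) \<le> ?B \<and> int (length (binary_int b)) \<le> ?B"
    and map: "map fraction ps = map p0 (index_list n) @ map p1 (index_list n)"
    using p(2) unfolding encodes_def p01 fraction_def by auto
  have len: "length ps = 2 * (n * (n - 1))"
    using arg_cong[OF map, of length] by (simp add: length_index_list)
  have "fraction x \<in> {0..1}" if "x \<in> set ps" for x
  proof -
    have "fraction x \<in> set (map fraction ps)" using that by simp
    then have "fraction x \<in> p0 ` index_pairs n \<union> p1 ` index_pairs n"
      unfolding map by (simp add: set_index_list)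
    then show ?thesis using p(1) by (auto simp: p01 probability_vectors_def)
  qed
  then have acc: "\<forall>x\<in>set ps. acceptable ?B x"
    using ps fraction_unit by (fastforce simp: acceptable_def)
  have nz: "\<forall>x\<in>set ps. snd x \<noteq> 0" using ps by auto
  show "decide q w"
    unfolding w decide_encode
    using n len acc weakly_causal_decided[OF n len nz p(1)[unfolded p01] map] p(3) p01 by blast
next
  assume dec: "decide q w"
  then obtain n ps where w: "w = encode n ps"
    unfolding decide_def decide_at_def by (metis check_true prod.collapse)
  let ?B = "poly q (int (2 * (n * (n - 1))))" and ?d = "n * (n - 1)"
  have n: "2 \<le> n" and len: "length ps = 2 * ?d" and acc: "\<forall>x\<in>set ps. acceptable ?B x"
    and tot: "sum_best (encode n ps) (int n) (int ?d) \<le> (int n - 1) * \<bar>product (encode n ps) (- 1)\<bar>"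
    using dec unfolding w decide_encode by blast+
  have nz: "\<forall>x\<in>set ps. snd x \<noteq> 0" using acc by (auto simp: acceptable_def)
  have unit: "fraction x \<in> {0..1}" if "x \<in> set ps" for x
    using acc that fraction_unit[of "snd x" "fst x"] by (auto simp: acceptable_def)
  \<comment> \<open>Recovers a vector from the list of its entries: as the index pairs are distinct,
    looking up the pair with number \<open>i\<close> returns entry \<open>i\<close>.\<close>
  define P where "P ys = restrict (\<lambda>e. the (map_of (zip (index_list n) ys) e)) (index_pairs n)" for ys :: "real list"
  have P: "map (P ys) (index_list n) = ys" "P ys \<in> index_pairs n \<rightarrow>\<^sub>E set ys" if "length ys = ?d" for ys
  proof -
    have nth: "P ys (index_list n ! i) = ys ! i" if "i < ?d" for i
    proof -
      have "index_list n ! i \<in> index_pairs n"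
        unfolding set_index_list[symmetric] using that by (simp add: length_index_list)
      then show ?thesis
        using that \<open>length ys = ?d\<close>
        by (simp add: P_def map_of_zip_nth distinct_index_list length_index_list)
    qed
    show "map (P ys) (index_list n) = ys"
      using nth \<open>length ys = ?d\<close> by (intro nth_equalityI) (simp_all add: length_index_list)
    then have "P ys ` index_pairs n = set ys" by (metis set_index_list set_map)
    then show "P ys \<in> index_pairs n \<rightarrow>\<^sub>E set ys" by (auto simp: P_def)
  qed
  define p0 where "p0 = P (take ?d (map fraction ps))"
  define p1 where "p1 = P (drop ?d (map fraction ps))"
  have map: "map fraction ps = map p0 (index_list n) @ map p1 (index_list n)"
    using len by (simp add: p0_def p1_def P(1))
  have "set (take ?d (map fraction ps)) \<subseteq> {0..1}" "set (drop ?d (map fraction ps)) \<subseteq> {0..1}"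
    using unit set_take_subset[of ?d "map fraction ps"] set_drop_subset[of ?d "map fraction ps"] by auto
  then have p: "(p0, p1) \<in> probability_vectors n"
    using P(2)[of "take ?d (map fraction ps)"] P(2)[of "drop ?d (map fraction ps)"] len
    unfolding probability_vectors_def p0_def p1_def by (auto simp: PiE_iff subset_iff)
  have "(p0, p1) \<in> weakly_causal n"
    using weakly_causal_decided[OF n len nz p map] tot by blast
  moreover have "encodes q n w (p0, p1)"
    unfolding encodes_def
    using w acc map by (intro exI[of _ ps]) (auto simp: acceptable_def fraction_def)
  ultimately show "w \<in> weakly_causal_correlations q"
    unfolding weakly_causal_correlations_def using n p by blast
qed

theorem corollary4:
  fixes q :: "int poly"
  shows "weakly_causal_correlations q \<in> class_P"
proof -
  have "weakly_causal_correlations q = {w. decide q w}" using decide_iff by blast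
  then show ?thesis using computable_class_P[OF computable_decide] by simp
qed

end
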